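(* Let $n\in\mathbb{N}$ and $\delta\in(0,1)$ with $1-\delta = \Omega(1)$, and let $m=n(1-\delta)$. In any open-addressing scheme that does not support reordering and inserts $m$ keys into an array of $n$ slots, with probability greater than $1/2$ there is some key whose probe complexity is $\Omega(\log\log n + \log^2 \delta^{-1})$.
   Context: An open-addressing scheme without reordering with capacity $n$: an array of $n$ slots indexed by $[n]$, initially empty; keys $k_1,\dots,k_m$ are inserted one after another; each key $k_i$ has an infinite probe sequence $H_1(k_i),H_2(k_i),\dots\in[n]^\infty$, and these probe sequences are i.i.d. across keys. To insert $k_i$, an (arbitrary, not necessarily greedy) insertion algorithm places $k_i$ into some currently unoccupied slot $H_j(k_i)$; placed elements are never moved. The probe complexity of $k_i$ is the index $j$ such that $k_i$ is placed in slot $H_j(k_i)$. $\log$ is base 2. *)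

theory Defs
  imports "HOL-Probability.Probability"
begin

text \<open>Infinite probe sequences \<open>H\<^sub>1, H\<^sub>2, \<dots>\<close> in the slot set \<open>{1..n}\<close>,
  with the product sigma-algebra.\<close>

definition probe_space :: "nat \<Rightarrow> (nat \<Rightarrow> nat) measure" where
  "probe_space n = (\<Pi>\<^sub>M j\<in>{1..}. count_space {1..n})"

text \<open>An outcome \<open>(r, H)\<close> consists of the internal randomness \<open>r\<close> of the insertion algorithm and,
  for every key \<open>i \<in> {1..m}\<close>, its probe sequence \<open>H i\<close>. The probe sequences are
  i.i.d. with law \<open>D\<close> (an arbitrary law, not necessarily uniform) and independent of \<open>r\<close>.\<close>

type_synonym outcome = "real \<times> (nat \<Rightarrow> nat \<Rightarrow> nat)"

definition run_space :: "nat \<Rightarrow> (nat \<Rightarrow> nat) measure \<Rightarrow> real measure \<Rightarrow> outcome measure" where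
  "run_space m D R = R \<Otimes>\<^sub>M (\<Pi>\<^sub>M i\<in>{1..m}. D)"

text \<open>The insertion algorithm is online: when key \<open>i\<close> arrives, \<open>choice i\<close> sees only the internal
  randomness and the probe sequences of the keys \<open>1, \<dots>, i\<close>. These determine all earlier
  placements, so the contents of the array need not be passed separately. The returned
  index \<open>j \<ge> 1\<close> means that the key is placed in the slot \<open>H i j\<close>.\<close>

definition probe_complexity :: "(nat \<Rightarrow> outcome \<Rightarrow> nat) \<Rightarrow> nat \<Rightarrow> outcome \<Rightarrow> nat" where
  "probe_complexity choice i \<omega> = choice i (fst \<omega>, restrict (snd \<omega>) {1..i})"

definition slot_of :: "(nat \<Rightarrow> outcome \<Rightarrow> nat) \<Rightarrow> nat \<Rightarrow> outcome \<Rightarrow> nat" where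
  "slot_of choice i \<omega> = snd \<omega> i (probe_complexity choice i \<omega>)"

text \<open>Placed elements are never moved, so the slots occupied when key \<open>i\<close> arrives are exactly
  those chosen for the keys before it.\<close>

definition occupied_before :: "(nat \<Rightarrow> outcome \<Rightarrow> nat) \<Rightarrow> nat \<Rightarrow> outcome \<Rightarrow> nat set" where
  "occupied_before choice i \<omega> = (\<lambda>k. slot_of choice k \<omega>) ` {1..<i}"

locale open_addressing_scheme =
  fixes n m :: nat
    and D :: "(nat \<Rightarrow> nat) measure"
    and R :: "real measure"
    and choice :: "nat \<Rightarrow> outcome \<Rightarrow> nat"
  assumes prob_D: "prob_space D"
    and sets_D: "sets D = sets (probe_space n)"
    and prob_R: "prob_space R"
    and choice_measurable:
      "\<And>i. i \<in> {1..m} \<Longrightarrow> choice i \<in> run_space i D R \<rightarrow>\<^sub>M count_space {1..}"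
    and placed_in_free_slot:
      "AE \<omega> in run_space m D R. \<forall>i\<in>{1..m}. slot_of choice i \<omega> \<notin> occupied_before choice i \<omega>"

end

theory Submission
  imports Defs "HOL-Real_Asymp.Real_Asymp"
begin

text \<open>Suppose that all probe complexities are at most \<open>T\<close>, so that only the first \<open>T\<close> probes of each
  key matter. Both lower bounds for \<open>T\<close> use that keys arriving later are independent of the set of
  slots that is occupied now.

  For \<open>log\<^sup>2 \<delta>\<^sup>-\<^sup>1\<close>: let \<open>l = log (1/\<delta>)\<close> and let \<open>q s\<close> be the probability that a key probes slot \<open>s\<close>,
  so that \<open>q\<close> sums to at most \<open>T\<close>. If for every \<open>i\<close> between \<open>1\<close> and \<open>l/4\<close> at least about \<open>n / 2^i\<close>
  slots had \<open>q s\<close> above about \<open>2^i l / n\<close>, then summing over \<open>i\<close> would give \<open>T \<ge> \<Omega>(l\<^sup>2)\<close>. Otherwise fix a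
  bad \<open>i\<close> and look at the last \<open>n / 2^i\<close> keys: most slots free before them have small \<open>q\<close>, and each
  of these is missed by all remaining keys with probability at least \<open>\<delta>\<^bsup>1/4\<^esup>\<close>. By Chebyshev more
  than \<open>\<delta>n\<close> slots stay empty, which is too many.

  For \<open>log log n\<close>: split the keys into \<open>T + 1\<close> rounds. The invariant after \<open>j\<close> rounds is a set \<open>J\<close> of
  \<open>j\<close> probe indices such that a fresh key has all its probes with index in \<open>J\<close> occupied with
  probability at least \<open>g\<^sub>j\<close>. In the next round about \<open>g\<^sub>j n / T\<close> keys are in this situation and have to
  use an index outside \<open>J\<close>; the most popular such index can be added to \<open>J\<close>, with
  \<open>g\<^bsub>j+1\<^esub> = \<kappa> g\<^sub>j\<^sup>2\<close> for some \<open>\<kappa>\<close> polynomial in \<open>1/T\<close>. After \<open>T + 1\<close> rounds \<open>J\<close> would have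
  \<open>T + 1\<close> elements, so some key fails unless \<open>g\<^sub>T\<close> is about \<open>1/n\<close>, that is, \<open>2^T\<close> is about \<open>log n\<close>.\<close>

section \<open>Second-moment bounds in product spaces\<close>

lemma card_events_eq_sum_indicator:
  "finite X \<Longrightarrow> real (card {x \<in> X. \<omega> \<in> B x}) = (\<Sum>x\<in>X. indicator (B x) \<omega>)"
  by (simp add: indicator_def sum.If_cases Int_def of_bool_def)

lemma sets_few_events:
  assumes "finite X" "\<And>x. x \<in> X \<Longrightarrow> B x \<in> sets M"
  shows "{\<omega> \<in> space M. real (card {x \<in> X. \<omega> \<in> B x}) \<le> c} \<in> sets M"
proof -
  have "(\<lambda>\<omega>. \<Sum>x\<in>X. indicator (B x) \<omega> :: real) \<in> borel_measurable M"
    using assms(2) by measurable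
  then show ?thesis
    unfolding card_events_eq_sum_indicator[OF assms(1)] by measurable
qed

text \<open>The left side is the expected number of events that occur, so a pointwise bound on that
  number carries over.\<close>

lemma (in prob_space) sum_prob_le:
  assumes fin: "finite X" and ev: "\<And>x. x \<in> X \<Longrightarrow> B x \<in> events"
    and le: "\<And>\<omega>. \<omega> \<in> space M \<Longrightarrow> card {x \<in> X. \<omega> \<in> B x} \<le> k"
  shows "(\<Sum>x\<in>X. prob (B x)) \<le> real k"
proof -
  have int: "integrable M (indicator (B x) :: 'a \<Rightarrow> real)" if "x \<in> X" for x
    using ev[OF that] by (simp add: integrable_indicator_iff emeasure_eq_measure)
  have "(\<Sum>x\<in>X. prob (B x)) = expectation (\<lambda>\<omega>. \<Sum>x\<in>X. indicator (B x) \<omega>)"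
    using ev by (subst Bochner_Integration.integral_sum) (auto intro!: int sum.cong)
  also have "\<dots> \<le> real k"
    by (rule integral_le_const, intro Bochner_Integration.integrable_sum int)
      (use le in \<open>auto simp: card_events_eq_sum_indicator[OF fin, symmetric]\<close>)
  finally show ?thesis .
qed

text \<open>Chebyshev for the number of events that occur. The double sum is its variance written as
  a sum of covariances, diagonal included, so no independence is assumed.\<close>

lemma (in prob_space) second_moment_lower_tail:
  fixes B :: "'i \<Rightarrow> 'a set"
  assumes fin: "finite X" and ev: "\<And>x. x \<in> X \<Longrightarrow> B x \<in> events"
    and V: "(\<Sum>x\<in>X. \<Sum>y\<in>X. prob (B x \<inter> B y) - prob (B x) * prob (B y)) \<le> V"
    and mu: "\<mu> \<le> (\<Sum>x\<in>X. prob (B x))" "\<mu> > 0"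
  shows "prob {\<omega> \<in> space M. real (card {x \<in> X. \<omega> \<in> B x}) \<le> \<mu> / 2} \<le> 4 * V / \<mu>\<^sup>2"
proof -
  define N :: "'a \<Rightarrow> real" where "N = (\<lambda>\<omega>. \<Sum>x\<in>X. indicator (B x) \<omega>)"
  have N_card: "N \<omega> = real (card {x \<in> X. \<omega> \<in> B x})" for \<omega>
    unfolding N_def card_events_eq_sum_indicator[OF fin] ..
  have N_sq: "(N \<omega>)\<^sup>2 = (\<Sum>x\<in>X. \<Sum>y\<in>X. indicator (B x \<inter> B y) \<omega>)" for \<omega>
    unfolding N_def power2_eq_square sum_product by (simp add: indicator_inter_arith)
  have [measurable]: "N \<in> borel_measurable M"
    unfolding N_def using ev by measurable
  have int_ind: "integrable M (indicator A :: 'a \<Rightarrow> real)" if "A \<in> events" for A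
    using that by (simp add: integrable_indicator_iff emeasure_eq_measure)
  have int1: "integrable M N"
    unfolding N_def by (intro Bochner_Integration.integrable_sum int_ind ev)
  have int2: "integrable M (\<lambda>\<omega>. (N \<omega>)\<^sup>2)"
    unfolding N_sq by (intro Bochner_Integration.integrable_sum int_ind sets.Int ev)
  have E1: "expectation N = (\<Sum>x\<in>X. prob (B x))"
    unfolding N_def using ev
    by (subst Bochner_Integration.integral_sum) (auto intro!: int_ind sum.cong)
  have E2: "expectation (\<lambda>\<omega>. (N \<omega>)\<^sup>2) = (\<Sum>x\<in>X. \<Sum>y\<in>X. prob (B x \<inter> B y))"
  proof -
    have "expectation (\<lambda>\<omega>. (N \<omega>)\<^sup>2)
        = (\<Sum>x\<in>X. expectation (\<lambda>\<omega>. \<Sum>y\<in>X. indicator (B x \<inter> B y) \<omega>))"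
      unfolding N_sq
      by (rule Bochner_Integration.integral_sum)
        (intro Bochner_Integration.integrable_sum int_ind sets.Int ev)
    also have "\<dots> = (\<Sum>x\<in>X. \<Sum>y\<in>X. expectation (indicator (B x \<inter> B y)))"
      by (intro sum.cong refl Bochner_Integration.integral_sum int_ind sets.Int ev)
    finally show ?thesis using ev by simp
  qed
  have var: "variance N \<le> V"
    using V variance_eq[OF int1 int2]
    by (simp add: E1 E2 sum_subtractf power2_eq_square[of "sum _ _"] sum_product)
  have "prob {\<omega> \<in> space M. real (card {x \<in> X. \<omega> \<in> B x}) \<le> \<mu> / 2}
      \<le> prob {\<omega> \<in> space M. \<bar>N \<omega> - expectation N\<bar> \<ge> \<mu> / 2}"
    using mu unfolding E1 N_card[symmetric]
    by (intro finite_measure_mono) auto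
  also have "\<dots> \<le> variance N / (\<mu> / 2)\<^sup>2"
    using mu int2 by (intro Chebyshev_inequality) auto
  also have "\<dots> \<le> V / (\<mu> / 2)\<^sup>2"
    using var by (intro divide_right_mono) auto
  also have "\<dots> = 4 * V / \<mu>\<^sup>2"
    by (simp add: power2_eq_square field_simps)
  finally show ?thesis .
qed

section \<open>Counting over independent keys in a finite product measure\<close>

context
  fixes D :: "'a measure" and J :: "'i set"
  assumes D: "prob_space D" and finJ: "finite J"
begin

interpretation D: prob_space D by (rule D)
interpretation P: product_prob_space "\<lambda>_. D" J by unfold_locales

lemma PiM_Ball_eq_prod_emb:
  assumes "I \<subseteq> J"
  shows "{h \<in> space (PiM J (\<lambda>_. D)). \<forall>i\<in>I. h i \<in> G i} = prod_emb J (\<lambda>_. D) I (Pi\<^sub>E I G)"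
  using assms by (auto simp: prod_emb_def space_PiM PiE_iff extensional_def)

lemma measure_PiM_Ball:
  assumes "I \<subseteq> J" "\<And>i. i \<in> I \<Longrightarrow> G i \<in> sets D"
  shows "measure (PiM J (\<lambda>_. D)) {h \<in> space (PiM J (\<lambda>_. D)). \<forall>i\<in>I. h i \<in> G i}
    = (\<Prod>i\<in>I. measure D (G i))"
  by (subst PiM_Ball_eq_prod_emb[OF assms(1)], rule P.measure_PiM_emb) (use assms finJ finite_subset in auto)

lemma sets_PiM_Ball:
  assumes "I \<subseteq> J" "\<And>i. i \<in> I \<Longrightarrow> G i \<in> sets D"
  shows "{h \<in> space (PiM J (\<lambda>_. D)). \<forall>i\<in>I. h i \<in> G i} \<in> sets (PiM J (\<lambda>_. D))"
  by (subst PiM_Ball_eq_prod_emb[OF assms(1)], rule sets_PiM_I) (use assms finJ finite_subset in auto)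

text \<open>The count is binomial with success probability \<open>q = measure D G\<close>, so its
  variance is at most its mean \<open>card I * q\<close>. Chebyshev is applied at \<open>q\<close>;
  passing to the lower bound \<open>p\<close> only shrinks the event and enlarges the bound.\<close>

lemma few_in_set:
  assumes "I \<subseteq> J" "G \<in> sets D" "p \<le> measure D G" "p > 0" "I \<noteq> {}"
  shows "measure (PiM J (\<lambda>_. D))
      {h \<in> space (PiM J (\<lambda>_. D)). real (card {i\<in>I. h i \<in> G}) \<le> real (card I) * p / 2}
    \<le> 4 / (real (card I) * p)"
proof -
  let ?P = "PiM J (\<lambda>_. D)"
  define B where "B i = {h \<in> space ?P. h i \<in> G}" for i
  define q where "q = measure D G"
  have finI: "finite I" using assms finJ finite_subset by blast
  have cI: "card I > 0" using finI assms by (simp add: card_gt_0_iff)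
  have B: "B i \<in> sets ?P" "P.prob (B i) = q" if "i \<in> I" for i
    using sets_PiM_Ball[of "{i}" "\<lambda>_. G"] measure_PiM_Ball[of "{i}" "\<lambda>_. G"] that assms
    by (auto simp: B_def q_def)
  have BB: "P.prob (B i \<inter> B j) = q * q" if "i \<in> I" "j \<in> I" "i \<noteq> j" for i j
  proof -
    have "B i \<inter> B j = {h \<in> space ?P. \<forall>k\<in>{i,j}. h k \<in> G}" by (auto simp: B_def)
    then show ?thesis
      using measure_PiM_Ball[of "{i,j}" "\<lambda>_. G"] that assms by (auto simp: q_def)
  qed
  have "(\<Sum>j\<in>I. P.prob (B i \<inter> B j) - P.prob (B i) * P.prob (B j)) \<le> q" if "i \<in> I" for i
  proof -
    have "(\<Sum>j\<in>I. P.prob (B i \<inter> B j) - P.prob (B i) * P.prob (B j))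
        \<le> (\<Sum>j\<in>I. if j = i then q else 0)"
      using that by (intro sum_mono) (auto simp: B BB)
    then show ?thesis using that finI by simp
  qed
  then have V: "(\<Sum>i\<in>I. \<Sum>j\<in>I. P.prob (B i \<inter> B j) - P.prob (B i) * P.prob (B j)) \<le> real (card I) * q"
    by (rule sum_bounded_above)
  have "P.prob {h \<in> space ?P. real (card {i\<in>I. h i \<in> G}) \<le> real (card I) * p / 2}
    \<le> P.prob {h \<in> space ?P. real (card {i\<in>I. h \<in> B i}) \<le> real (card I) * q / 2}"
  proof (rule P.finite_measure_mono)
    show "{h \<in> space ?P. real (card {i\<in>I. h \<in> B i}) \<le> real (card I) * q / 2} \<in> sets ?P"
      by (intro sets_few_events finI B)
    have "real (card I) * p \<le> real (card I) * q"
      using assms by (intro mult_left_mono) (auto simp: q_def)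
    then show "{h \<in> space ?P. real (card {i\<in>I. h i \<in> G}) \<le> real (card I) * p / 2}
      \<subseteq> {h \<in> space ?P. real (card {i\<in>I. h \<in> B i}) \<le> real (card I) * q / 2}"
      by (auto simp: B_def)
  qed
  also have "\<dots> \<le> 4 * (real (card I) * q) / (real (card I) * q)\<^sup>2"
    using B assms cI by (intro P.second_moment_lower_tail[OF finI _ V]) (auto simp: q_def)
  also have "\<dots> = 4 / (real (card I) * q)"
    using cI assms by (simp add: power2_eq_square q_def)
  also have "\<dots> \<le> 4 / (real (card I) * p)"
    using cI assms by (intro divide_left_mono mult_left_mono mult_pos_pos) (auto simp: q_def)
  finally show ?thesis .
qed

lemma sets_few_in_set:
  assumes "I \<subseteq> J" "G \<in> sets D"
  shows "{h \<in> space (PiM J (\<lambda>_. D)). real (card {i\<in>I. h i \<in> G}) \<le> c} \<in> sets (PiM J (\<lambda>_. D))"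
proof -
  let ?P = "PiM J (\<lambda>_. D)"
  have "{h \<in> space ?P. real (card {i\<in>I. h \<in> {h \<in> space ?P. \<forall>k\<in>{i}. h k \<in> G}}) \<le> c} \<in> sets ?P"
    by (intro sets_few_events sets_PiM_Ball) (use assms finJ finite_subset in auto)
  then show ?thesis by (simp cong: conj_cong)
qed

lemma sets_few_missed:
  assumes "I \<subseteq> J" "finite S" "\<And>s. s \<in> S \<Longrightarrow> H s \<in> sets D"
  shows "{h \<in> space (PiM J (\<lambda>_. D)). real (card {s\<in>S. \<forall>i\<in>I. h i \<notin> H s}) \<le> c} \<in> sets (PiM J (\<lambda>_. D))"
proof -
  let ?P = "PiM J (\<lambda>_. D)"
  have "{h \<in> space ?P. real (card {s\<in>S. h \<in> {h \<in> space ?P. \<forall>i\<in>I. h i \<in> space D - H s}}) \<le> c} \<in> sets ?P"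
    by (intro sets_few_events sets_PiM_Ball) (use assms in auto)
  moreover have "h i \<in> space D" if "h \<in> space ?P" "i \<in> I" for h i
    using that assms(1) by (auto simp: space_PiM)
  ultimately show ?thesis by (simp cong: conj_cong)
qed

text \<open>Independence of the keys makes each miss probability a power. \<open>W\<close> bounds
  the joint hits of a single key, the only source of positive covariance.\<close>

lemma few_missed:
  assumes I: "I \<subseteq> J" and finS: "finite S" and H: "\<And>s. s \<in> S \<Longrightarrow> H s \<in> sets D"
    and W: "(\<Sum>s\<in>S. \<Sum>s'\<in>S. measure D (H s \<inter> H s')) \<le> W"
    and mu: "\<mu> \<le> (\<Sum>s\<in>S. (1 - measure D (H s)) ^ card I)" "\<mu> > 0"
  shows "measure (PiM J (\<lambda>_. D))
      {h \<in> space (PiM J (\<lambda>_. D)). real (card {s\<in>S. \<forall>i\<in>I. h i \<notin> H s}) \<le> \<mu> / 2}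
    \<le> 4 * (real (card I) * W) / \<mu>\<^sup>2"
proof -
  let ?P = "PiM J (\<lambda>_. D)"
  define B where "B s = {h \<in> space ?P. \<forall>i\<in>I. h i \<in> space D - H s}" for s
  have space_h: "h i \<in> space D" if "h \<in> space ?P" "i \<in> I" for h i
    using that I by (auto simp: space_PiM)
  have B: "B s \<in> sets ?P" "P.prob (B s) = (1 - measure D (H s)) ^ card I" if "s \<in> S" for s
    using sets_PiM_Ball[of I "\<lambda>_. space D - H s"] measure_PiM_Ball[of I "\<lambda>_. space D - H s"] that I H
    by (auto simp: B_def D.prob_compl)
  have BB: "P.prob (B s \<inter> B s') = (1 - measure D (H s \<union> H s')) ^ card I" if "s \<in> S" "s' \<in> S" for s s'
  proof -
    have "B s \<inter> B s' = {h \<in> space ?P. \<forall>i\<in>I. h i \<in> space D - (H s \<union> H s')}" by (auto simp: B_def)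
    then show ?thesis
      using measure_PiM_Ball[of I "\<lambda>_. space D - (H s \<union> H s')"] that I H
      by (auto simp: D.prob_compl)
  qed
  \<comment> \<open>Hits of one key may be positively correlated, so the covariance is bounded via the
    \<open>k\<close>-Lipschitz bound for the \<open>k\<close>-th power on \<open>[0, 1]\<close>.\<close>
  have cov: "P.prob (B s \<inter> B s') - P.prob (B s) * P.prob (B s') \<le> card I * measure D (H s \<inter> H s')"
    if "s \<in> S" "s' \<in> S" for s s'
  proof -
    define x where "x = 1 - measure D (H s \<union> H s')"
    define y where "y = (1 - measure D (H s)) * (1 - measure D (H s'))"
    have x: "0 \<le> x" "x \<le> 1" and y: "0 \<le> y" "y \<le> 1"
      by (auto simp: x_def y_def mult_le_one)
    have "measure D (H s \<union> H s') = measure D (H s) + measure D (H s') - measure D (H s \<inter> H s')"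
      using that H by (intro measure_Un3) (auto simp: D.emeasure_eq_measure fmeasurable_def)
    then have xy: "x \<le> y + measure D (H s \<inter> H s')"
    proof -
      have "y = 1 - measure D (H s) - measure D (H s') + measure D (H s) * measure D (H s')"
        by (simp add: y_def algebra_simps)
      moreover have "0 \<le> measure D (H s) * measure D (H s')" by simp
      ultimately show ?thesis using \<open>measure D (H s \<union> H s') = _\<close> by (simp add: x_def)
    qed
    have "x ^ card I - y ^ card I \<le> card I * measure D (H s \<inter> H s')"
    proof (cases "x \<le> y")
      case True
      then have "x ^ card I \<le> y ^ card I" using x by (intro power_mono)
      then show ?thesis by (meson diff_le_0_iff_le measure_nonneg mult_nonneg_nonneg of_nat_0_le_iff order_trans)
    next
      case False
      have "norm (x ^ card I - y ^ card I) \<le> card I * norm (x - y)"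
        by (rule norm_power_diff) (use x y in auto)
      then have "x ^ card I - y ^ card I \<le> card I * (x - y)" using False by simp
      also have "\<dots> \<le> card I * measure D (H s \<inter> H s')" using xy by (intro mult_left_mono) auto
      finally show ?thesis .
    qed
    then show ?thesis using that by (simp add: B BB x_def y_def power_mult_distrib)
  qed
  have "(\<Sum>s\<in>S. \<Sum>s'\<in>S. P.prob (B s \<inter> B s') - P.prob (B s) * P.prob (B s'))
      \<le> (\<Sum>s\<in>S. \<Sum>s'\<in>S. card I * measure D (H s \<inter> H s'))"
    by (intro sum_mono cov)
  also have "\<dots> \<le> card I * W" using W by (simp add: sum_distrib_left[symmetric] mult_left_mono)
  finally have V: "(\<Sum>s\<in>S. \<Sum>s'\<in>S. P.prob (B s \<inter> B s') - P.prob (B s) * P.prob (B s')) \<le> card I * W" .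
  have "P.prob {h \<in> space ?P. real (card {s\<in>S. h \<in> B s}) \<le> \<mu> / 2} \<le> 4 * (card I * W) / \<mu>\<^sup>2"
    using B mu by (intro P.second_moment_lower_tail[OF finS _ V]) auto
  also have "{h \<in> space ?P. real (card {s\<in>S. h \<in> B s}) \<le> \<mu> / 2}
    = {h \<in> space ?P. real (card {s\<in>S. \<forall>i\<in>I. h i \<notin> H s}) \<le> \<mu> / 2}"
  proof (intro Collect_cong conj_cong refl)
    fix h assume "h \<in> space ?P"
    then have "{s\<in>S. h \<in> B s} = {s\<in>S. \<forall>i\<in>I. h i \<notin> H s}" using space_h by (auto simp: B_def)
    then show "(real (card {s\<in>S. h \<in> B s}) \<le> \<mu> / 2) = (real (card {s\<in>S. \<forall>i\<in>I. h i \<notin> H s}) \<le> \<mu> / 2)" by simp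
  qed
  finally show ?thesis .
qed

end

section \<open>Real estimates\<close>

text \<open>A geometric sum is at most twice its largest term.\<close>

lemma sum_powers_of_two_less:
  assumes "finite A" "b \<ge> (0::real)" "\<And>i. i \<in> A \<Longrightarrow> 2 ^ i < b"
  shows "(\<Sum>i\<in>A. (2::real) ^ i) \<le> 2 * b"
proof (cases "A = {}")
  case False
  have "(\<Sum>i\<in>A. (2::real) ^ i) \<le> (\<Sum>i\<in>{..Max A}. 2 ^ i)"
    using assms by (intro sum_mono2) auto
  also have "\<dots> \<le> 2 * 2 ^ Max A"
  proof -
    have "(\<Sum>i\<le>k. (2::real) ^ i) \<le> 2 * 2 ^ k" for k by (induction k) auto
    then show ?thesis .
  qed
  also have "\<dots> \<le> 2 * b" using assms(3)[of "Max A"] assms(1) False by auto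
  finally show ?thesis .
qed (use assms in auto)

lemma one_minus_power_ge_exp:
  assumes "0 \<le> a" "a \<le> (1/2 :: real)"
  shows "(1 - a) ^ k \<ge> exp (- 2 * a * k)"
proof -
  have "- a - 2 * a\<^sup>2 \<le> ln (1 - a)" using ln_one_minus_pos_lower_bound[of a] assms by auto
  moreover have "2 * a * a \<le> 1 * a" using assms by (intro mult_right_mono) auto
  ultimately have "- 2 * a \<le> ln (1 - a)" by (simp add: power2_eq_square)
  then have "exp (- 2 * a) \<le> 1 - a" using assms by (subst (asm) ln_ge_iff) auto
  then have "exp (- 2 * a) ^ k \<le> (1 - a) ^ k" by (intro power_mono) auto
  then show ?thesis by (simp add: exp_of_nat_mult[symmetric] mult.commute)
qed

text \<open>For \<open>l = log 2 (1 / \<delta>)\<close> the quantity \<open>2 powr (- l / 4)\<close>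
  is the fourth root of \<delta>; its decay beats the powers of \<open>l\<close> that arise in the
  load bound.\<close>

lemma log_squared_threshold:
  obtains l0 :: real where "l0 \<ge> 8"
    "\<And>l. l \<ge> l0 \<Longrightarrow> 2 powr (- l / 4) < 1/8"
    "\<And>l. l \<ge> l0 \<Longrightarrow> l * 2 powr (- l / 4) < 8"
    "\<And>l. l \<ge> l0 \<Longrightarrow> l ^ 4 * 2 powr (- l / 4) < 1"
proof -
  have "eventually (\<lambda>l::real. 2 powr (- l / 4) < 1/8) at_top" by real_asymp
  moreover have "eventually (\<lambda>l::real. l * 2 powr (- l / 4) < 8) at_top" by real_asymp
  moreover have "eventually (\<lambda>l::real. l ^ 4 * 2 powr (- l / 4) < 1) at_top" by real_asymp
  ultimately have "eventually (\<lambda>l::real. 2 powr (- l / 4) < 1/8 \<and> l * 2 powr (- l / 4) < 8 \<and> l ^ 4 * 2 powr (- l / 4) < 1) at_top"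
    by eventually_elim auto
  then obtain l1 where "\<And>l::real. l \<ge> l1 \<Longrightarrow> 2 powr (- l / 4) < 1/8 \<and> l * 2 powr (- l / 4) < 8 \<and> l ^ 4 * 2 powr (- l / 4) < 1"
    unfolding eventually_at_top_linorder by blast
  then show thesis by (intro that[of "max 8 l1"]) auto
qed

text \<open>The base is polynomial in \<open>T\<close>, so the logarithm of the left side is only
  singly exponential in \<open>T\<close>; a constant \<open>N\<close> depending on \<open>c\<close>
  alone absorbs it.\<close>

lemma loglog_threshold:
  fixes c :: real
  assumes "c > 0"
  obtains N :: nat where "N \<ge> 1"
    "\<And>(T::nat) x. T \<ge> 1 \<Longrightarrow> 2 ^ (2 ^ (N * T)) \<le> x \<Longrightarrow> (128 * real T ^ 3 / c) ^ (2 ^ T + 1) < x"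
proof -
  obtain a :: nat where a: "128 / c < 2 ^ a"
    using real_arch_pow[of 2 "128 / c"] by auto
  have "(128 * real T ^ 3 / c) ^ (2 ^ T + 1) < x" if T: "T \<ge> 1" and x: "2 ^ (2 ^ ((a + 7) * T)) \<le> x" for T :: nat and x
  proof -
    have "real T < 2 ^ T" using of_nat_less_two_power[of T, where 'a = real] by simp
    then have "real T ^ 3 < (2 ^ T) ^ 3" by (intro power_strict_mono) auto
    then have "128 / c * real T ^ 3 < 2 ^ a * (2 ^ T) ^ 3"
      using a assms T by (intro mult_strict_mono') auto
    also have "2 ^ a * (2 ^ T) ^ 3 = (2::real) ^ (a + 3 * T)" by (simp add: power_add power_mult mult.commute)
    finally have "(128 * real T ^ 3 / c) ^ (2 ^ T + 1) < (2 ^ (a + 3 * T)) ^ (2 ^ T + 1)"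
      using assms by (intro power_strict_mono) (auto simp: field_simps)
    also have "\<dots> = (2::real) ^ ((a + 3 * T) * (2 ^ T + 1))" by (rule power_mult[symmetric])
    also have "\<dots> \<le> 2 ^ (2 ^ ((a + 7) * T))"
    proof (rule power_increasing)
      \<comment> \<open>The two factors are at most \<open>2 ^ (a + 3) * 2 ^ T\<close> and
        \<open>2 * 2 ^ T\<close>, so the product has exponent \<open>a + 4 + 2 * T\<close>, which
        fits into \<open>(a + 7) * T\<close>.\<close>
      have "a + 3 * T \<le> (a + 3) * T" using T by (simp add: algebra_simps)
      also have "\<dots> \<le> 2 ^ (a + 3) * 2 ^ T" by (intro mult_le_mono less_imp_le less_exp)
      finally have "(a + 3 * T) * (2 ^ T + 1) \<le> (2 ^ (a + 3) * 2 ^ T) * (2 * 2 ^ T)"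
        by (rule mult_le_mono) simp
      also have "\<dots> = 2 ^ (a + 3 + T + Suc T)" by (simp only: power_add power_Suc)
      also have "\<dots> \<le> 2 ^ ((a + 7) * T)"
      proof (rule power_increasing)
        have "a \<le> a * T" using T mult_le_mono[of a a 1 T] by simp
        moreover have "(a + 7) * T = a * T + 7 * T" by (simp add: algebra_simps)
        ultimately show "a + 3 + T + Suc T \<le> (a + 7) * T" using T by linarith
      qed simp
      finally show "(a + 3 * T) * (2 ^ T + 1) \<le> 2 ^ ((a + 7) * T)" .
    qed simp
    finally show ?thesis using x by linarith
  qed
  then show thesis by (intro that[of "a + 7"]) auto
qed

section \<open>Independence of occupied slots and later keys\<close>

context open_addressing_scheme
begin

interpretation D: prob_space D by (rule prob_D)

lemma space_D: "space D = PiE {1..} (\<lambda>_. {1..n})"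
  using sets_eq_imp_space_eq[OF sets_D] by (simp add: probe_space_def space_PiM)

lemma probe_measurable: "j \<ge> 1 \<Longrightarrow> (\<lambda>x. x j) \<in> D \<rightarrow>\<^sub>M count_space {1..n}"
  unfolding measurable_cong_sets[OF sets_D refl] probe_space_def
  by (rule measurable_component_singleton) simp

lemma prob_run_space: "prob_space (run_space t D R)"
  unfolding run_space_def
  by (intro prob_space_pair prob_R prob_space_PiM prob_D)

lemma prefix_measurable:
  assumes "t \<le> t'"
  shows "(\<lambda>\<omega>. (fst \<omega>, restrict (snd \<omega>) {1..t})) \<in> run_space t' D R \<rightarrow>\<^sub>M run_space t D R"
  unfolding run_space_def
  by (intro measurable_Pair measurable_fst measurable_compose[OF measurable_snd] measurable_restrict_subset)
    (use assms in auto)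

lemma probe_complexity_prefix:
  "i \<le> t \<Longrightarrow> probe_complexity choice i (fst \<omega>, restrict (snd \<omega>) {1..t}) = probe_complexity choice i \<omega>"
  by (simp add: probe_complexity_def Int_absorb1)

lemma slot_of_prefix:
  "i \<in> {1..t} \<Longrightarrow> slot_of choice i (fst \<omega>, restrict (snd \<omega>) {1..t}) = slot_of choice i \<omega>"
  by (simp add: slot_of_def probe_complexity_prefix del: One_nat_def)

text \<open>\<open>occupied_before choice (Suc t)\<close> consists of the slots taken by keys
  \<open>1, ..., t\<close>. As the algorithm is online, it is a function of the prefix of the
  outcome; all independence used later rests on this.\<close>

lemma occupied_before_prefix:
  "occupied_before choice (Suc t) (fst \<omega>, restrict (snd \<omega>) {1..t}) = occupied_before choice (Suc t) \<omega>"
  unfolding occupied_before_def by (intro image_cong refl slot_of_prefix) auto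

section \<open>Measurability of placements\<close>

lemma probe_complexity_measurable:
  assumes "i \<in> {1..t}" "t \<le> m"
  shows "probe_complexity choice i \<in> run_space t D R \<rightarrow>\<^sub>M count_space {1..}"
proof -
  have "probe_complexity choice i = choice i \<circ> (\<lambda>\<omega>. (fst \<omega>, restrict (snd \<omega>) {1..i}))"
    by (auto simp: probe_complexity_def)
  then show ?thesis
    using measurable_comp[OF prefix_measurable[of i t] choice_measurable[of i]] assms by simp
qed

lemma slot_of_measurable:
  assumes "i \<in> {1..t}" "t \<le> m"
  shows "slot_of choice i \<in> run_space t D R \<rightarrow>\<^sub>M count_space {1..n}"
proof -
  have "(\<lambda>\<omega>. snd \<omega> i j) \<in> run_space t D R \<rightarrow>\<^sub>M count_space {1..n}" if "j \<in> {1..}" for j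
  proof -
    have "(\<lambda>\<omega>. snd \<omega> i) \<in> run_space t D R \<rightarrow>\<^sub>M D"
      unfolding run_space_def
      by (rule measurable_compose[OF measurable_snd measurable_component_singleton[OF assms(1)]])
    then show ?thesis
      using measurable_compose[OF _ probe_measurable[of j]] that by simp
  qed
  \<comment> \<open>The probe index is itself random, so measurability is pieced together over its
    countably many values.\<close>
  then have "(\<lambda>\<omega>. snd \<omega> i (probe_complexity choice i \<omega>)) \<in> run_space t D R \<rightarrow>\<^sub>M count_space {1..n}"
    by (rule measurable_compose_countable'[OF _ probe_complexity_measurable[OF assms]]) auto
  then show ?thesis by (simp add: slot_of_def[abs_def])
qed

lemma probe_complexity_ge_1:
  assumes "\<omega> \<in> space (run_space m D R)" "i \<in> {1..m}"
  shows "probe_complexity choice i \<omega> \<ge> 1"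
  using measurable_space[OF probe_complexity_measurable assms(1)] assms(2) by auto

lemma slot_of_in:
  assumes "\<omega> \<in> space (run_space m D R)" "i \<in> {1..m}"
  shows "slot_of choice i \<omega> \<in> {1..n}"
  using measurable_space[OF slot_of_measurable assms(1)] assms(2) by auto

lemma occupied_before_subset:
  assumes "\<omega> \<in> space (run_space m D R)" "t \<le> m"
  shows "occupied_before choice (Suc t) \<omega> \<subseteq> {1..n}"
  using slot_of_in[OF assms(1)] assms(2) unfolding occupied_before_def by force

lemma snd_in_space_D:
  assumes "\<omega> \<in> space (run_space m D R)" "i \<in> {1..m}"
  shows "snd \<omega> i \<in> space D"
  using assms by (auto simp: run_space_def space_pair_measure space_PiM)

lemma sets_occupied_before_eq:
  assumes "t \<le> m"
  shows "{\<omega> \<in> space (run_space t D R). occupied_before choice (Suc t) \<omega> = B} \<in> sets (run_space t D R)"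
proof -
  let ?N = "run_space t D R"
  have slot_in: "slot_of choice i \<omega> \<in> {1..n}" if "\<omega> \<in> space ?N" "i \<in> {1..t}" for \<omega> i
    using measurable_space[OF slot_of_measurable that(1)] that(2) assms by auto
  have ev: "{\<omega> \<in> space ?N. slot_of choice i \<omega> = s} \<in> sets ?N" if "i \<in> {1..t}" for i s
  proof -
    have "{\<omega> \<in> space ?N. slot_of choice i \<omega> = s} = slot_of choice i -` ({s} \<inter> {1..n}) \<inter> space ?N"
      using slot_in that by auto
    also have "\<dots> \<in> sets ?N"
      by (rule measurable_sets[OF slot_of_measurable[OF that assms]]) simp
    finally show ?thesis .
  qed
  \<comment> \<open>A \<open>B\<close> outside the slot range gives the empty event; otherwise
    comparison slot by slot is a finite Boolean combination of placement events.\<close>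
  have eq: "{\<omega> \<in> space ?N. occupied_before choice (Suc t) \<omega> = B}
     = (if B \<subseteq> {1..n} then {\<omega> \<in> space ?N. \<forall>s\<in>{1..n}. (s \<in> B) = (\<exists>i\<in>{1..t}. slot_of choice i \<omega> = s)} else {})"
  proof -
    have "(occupied_before choice (Suc t) \<omega> = B)
      = (B \<subseteq> {1..n} \<and> (\<forall>s\<in>{1..n}. (s \<in> B) = (\<exists>i\<in>{1..t}. slot_of choice i \<omega> = s)))"
      if \<omega>: "\<omega> \<in> space ?N" for \<omega>
    proof -
      have "occupied_before choice (Suc t) \<omega> = {s \<in> {1..n}. \<exists>i\<in>{1..t}. slot_of choice i \<omega> = s}"
        using slot_in[OF \<omega>] by (auto simp: occupied_before_def atLeastLessThanSuc_atLeastAtMost)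
      moreover have "({s \<in> X. P s} = B) = (B \<subseteq> X \<and> (\<forall>s\<in>X. (s \<in> B) = P s))" for X and P :: "nat \<Rightarrow> bool"
        by (auto simp: set_eq_iff)
      ultimately show ?thesis by (simp only:)
    qed
    then show ?thesis
      by (cases "B \<subseteq> {1..n}") (simp_all cong: conj_cong del: One_nat_def)
  qed
  have "{\<omega> \<in> space ?N. \<forall>s\<in>{1..n}. (s \<in> B) = (\<exists>i\<in>{1..t}. slot_of choice i \<omega> = s)} \<in> sets ?N"
  proof (intro sets.sets_Collect_finite_All)
    fix s
    have ex: "{\<omega> \<in> space ?N. \<exists>i\<in>{1..t}. slot_of choice i \<omega> = s} \<in> sets ?N"
      by (intro sets.sets_Collect_finite_Ex ev) auto
    show "{\<omega> \<in> space ?N. (s \<in> B) = (\<exists>i\<in>{1..t}. slot_of choice i \<omega> = s)} \<in> sets ?N"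
      using ex sets.sets_Collect_neg[OF ex] by (cases "s \<in> B") auto
  qed auto
  then show ?thesis unfolding eq by auto
qed

text \<open>The past \<open>(r, H 1, ..., H t)\<close> and the later probe sequences are
  independent: for fixed \<open>r\<close> the product over keys factors, and the suffix factor,
  being constant in \<open>r\<close>, leaves the integral.\<close>

lemma emeasure_prefix_suffix:
  assumes t: "t \<le> m" and A: "A \<in> sets (run_space t D R)" and B: "B \<in> sets (\<Pi>\<^sub>M i\<in>{t<..m}. D)"
  defines "E \<equiv> {\<omega> \<in> space (run_space m D R).
      (fst \<omega>, restrict (snd \<omega>) {1..t}) \<in> A \<and> restrict (snd \<omega>) {t<..m} \<in> B}"
  shows "E \<in> sets (run_space m D R)"
    and "emeasure (run_space m D R) E
      = emeasure (run_space t D R) A * emeasure (\<Pi>\<^sub>M i\<in>{t<..m}. D) B"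
proof -
  let ?I = "{1..t}" and ?J = "{t<..m}"
  let ?P = "\<lambda>K. PiM K (\<lambda>_::nat. D)"
  interpret PS: product_sigma_finite "\<lambda>_::nat. D" by unfold_locales
  interpret PI: prob_space "?P K" for K by (intro prob_space_PiM prob_D)
  have IJ: "?I \<union> ?J = {1..m}" "?I \<inter> ?J = {}" using t by auto
  have m1: "(\<lambda>\<omega>. restrict (snd \<omega>) ?J) \<in> run_space m D R \<rightarrow>\<^sub>M ?P ?J"
    unfolding run_space_def
    by (intro measurable_compose[OF measurable_snd] measurable_restrict_subset) (use t in auto)
  have "E = ((\<lambda>\<omega>. (fst \<omega>, restrict (snd \<omega>) ?I)) -` A \<inter> space (run_space m D R))
      \<inter> ((\<lambda>\<omega>. restrict (snd \<omega>) ?J) -` B \<inter> space (run_space m D R))"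
    by (auto simp: E_def)
  then show E: "E \<in> sets (run_space m D R)"
    using measurable_sets[OF prefix_measurable[OF t] A] measurable_sets[OF m1 B] by auto
  have inner: "emeasure (?P {1..m}) (Pair r -` E) = emeasure (?P ?I) (Pair r -` A) * emeasure (?P ?J) B"
    if r: "r \<in> space R" for r
  proof -
    have Ar: "Pair r -` A \<in> sets (?P ?I)" and Er: "Pair r -` E \<in> sets (?P {1..m})"
      using sets_Pair1 A E by (auto simp: run_space_def)
    \<comment> \<open>The product over all keys is the image of the product of the two blocks under
      \<open>merge\<close>, and the preimage of the section of \<open>E\<close> is a
      rectangle.\<close>
    have "emeasure (?P {1..m}) (Pair r -` E)
      = emeasure (distr (?P ?I \<Otimes>\<^sub>M ?P ?J) (?P (?I \<union> ?J)) (merge ?I ?J)) (Pair r -` E)"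
      by (subst PS.distr_merge) (simp_all only: IJ finite_atLeastAtMost finite_greaterThanAtMost)
    also have "\<dots> = emeasure (?P ?I \<Otimes>\<^sub>M ?P ?J) (merge ?I ?J -` (Pair r -` E) \<inter> space (?P ?I \<Otimes>\<^sub>M ?P ?J))"
      by (rule emeasure_distr[OF measurable_merge]) (simp only: IJ Er)
    also have "merge ?I ?J -` (Pair r -` E) \<inter> space (?P ?I \<Otimes>\<^sub>M ?P ?J) = (Pair r -` A) \<times> B"
    proof -
      have "(merge ?I ?J z \<in> Pair r -` E) = (z \<in> (Pair r -` A) \<times> B)"
        if z: "z \<in> space (?P ?I \<Otimes>\<^sub>M ?P ?J)" for z
      proof -
        obtain x y where xy: "z = (x, y)" "x \<in> space (?P ?I)" "y \<in> space (?P ?J)"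
          using z by (cases z) (auto simp: space_pair_measure)
        have "restrict (merge ?I ?J z) ?I = x" "restrict (merge ?I ?J z) ?J = y"
          using xy IJ by (auto simp: restrict_merge space_PiM PiE_def)
        moreover have "merge ?I ?J z \<in> space (?P {1..m})"
          using measurable_space[OF measurable_merge z] by (simp only: IJ)
        then have "(r, merge ?I ?J z) \<in> space (run_space m D R)"
          using r by (auto simp: run_space_def space_pair_measure)
        ultimately show ?thesis by (auto simp: E_def xy)
      qed
      moreover have "(Pair r -` A) \<times> B \<subseteq> space (?P ?I \<Otimes>\<^sub>M ?P ?J)"
        using sets.sets_into_space[OF Ar] sets.sets_into_space[OF B] by (auto simp: space_pair_measure)
      ultimately show ?thesis by blast
    qed
    also have "emeasure (?P ?I \<Otimes>\<^sub>M ?P ?J) ((Pair r -` A) \<times> B)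
      = emeasure (?P ?I) (Pair r -` A) * emeasure (?P ?J) B"
      by (rule PI.emeasure_pair_measure_Times[OF Ar B])
    finally show ?thesis .
  qed
  have "emeasure (run_space m D R) E = (\<integral>\<^sup>+r. emeasure (?P {1..m}) (Pair r -` E) \<partial>R)"
    unfolding run_space_def by (rule PI.emeasure_pair_measure_alt) (use E in \<open>simp add: run_space_def\<close>)
  also have "\<dots> = (\<integral>\<^sup>+r. emeasure (?P ?I) (Pair r -` A) * emeasure (?P ?J) B \<partial>R)"
    by (intro nn_integral_cong inner)
  also have "\<dots> = (\<integral>\<^sup>+r. emeasure (?P ?I) (Pair r -` A) \<partial>R) * emeasure (?P ?J) B"
    by (intro nn_integral_multc PI.measurable_emeasure_Pair) (use A in \<open>simp add: run_space_def\<close>)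
  also have "(\<integral>\<^sup>+r. emeasure (?P ?I) (Pair r -` A) \<partial>R) = emeasure (run_space t D R) A"
    unfolding run_space_def
    by (rule PI.emeasure_pair_measure_alt[symmetric]) (use A in \<open>simp add: run_space_def\<close>)
  finally show "emeasure (run_space m D R) E
      = emeasure (run_space t D R) A * emeasure (?P ?J) B" .
qed

text \<open>Summing over the finitely many occupied sets \<open>B\<close> replaces conditioning on the past.\<close>

lemma suffix_given_occupied:
  assumes t: "t \<le> m" and Q: "\<And>B. B \<subseteq> {1..n} \<Longrightarrow> Q B \<in> sets (\<Pi>\<^sub>M i\<in>{t<..m}. D)"
    and le: "\<And>B. B \<subseteq> {1..n} \<Longrightarrow> measure (\<Pi>\<^sub>M i\<in>{t<..m}. D) (Q B) \<le> e"
  defines "E \<equiv> {\<omega> \<in> space (run_space m D R).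
      restrict (snd \<omega>) {t<..m} \<in> Q (occupied_before choice (Suc t) \<omega>)}"
  shows "E \<in> sets (run_space m D R)" and "measure (run_space m D R) E \<le> e"
proof -
  interpret M: prob_space "run_space k D R" for k by (rule prob_run_space)
  interpret PI: prob_space "PiM {t<..m} (\<lambda>_. D)" by (intro prob_space_PiM prob_D)
  define A where "A B = {\<omega> \<in> space (run_space t D R). occupied_before choice (Suc t) \<omega> = B}" for B
  define F where "F B = {\<omega> \<in> space (run_space m D R).
      (fst \<omega>, restrict (snd \<omega>) {1..t}) \<in> A B \<and> restrict (snd \<omega>) {t<..m} \<in> Q B}" for B
  have A: "A B \<in> sets (run_space t D R)" for B
    unfolding A_def by (rule sets_occupied_before_eq[OF t])
  have F: "F B \<in> sets (run_space m D R)"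
    "M.prob m (F B) = M.prob t (A B) * measure (\<Pi>\<^sub>M i\<in>{t<..m}. D) (Q B)" if "B \<subseteq> {1..n}" for B
    using emeasure_prefix_suffix[OF t A[of B] Q[OF that]]
    unfolding F_def measure_def by (simp_all only: enn2real_mult)
  have E_eq: "E = (\<Union>B\<in>Pow {1..n}. F B)"
  proof (intro set_eqI)
    fix \<omega>
    show "\<omega> \<in> E \<longleftrightarrow> \<omega> \<in> (\<Union>B\<in>Pow {1..n}. F B)"
    proof (cases "\<omega> \<in> space (run_space m D R)")
      case True
      have "(fst \<omega>, restrict (snd \<omega>) {1..t}) \<in> space (run_space t D R)"
        "occupied_before choice (Suc t) \<omega> \<in> Pow {1..n}"
        using measurable_space[OF prefix_measurable[OF t] True] occupied_before_subset[OF True t] by auto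
      then show ?thesis
        using True by (simp add: E_def F_def A_def occupied_before_prefix del: One_nat_def)
    qed (simp add: E_def F_def)
  qed
  show "E \<in> sets (run_space m D R)"
    unfolding E_eq using F by (intro sets.finite_UN) auto
  have "0 \<le> e" using le[of "{}"] measure_nonneg order_trans by blast
  have "M.prob m E = (\<Sum>B\<in>Pow {1..n}. M.prob m (F B))"
    unfolding E_eq
    by (rule M.finite_measure_finite_Union)
      (use F in \<open>auto simp: disjoint_family_on_def F_def A_def\<close>)
  also have "\<dots> = (\<Sum>B\<in>Pow {1..n}. M.prob t (A B) * measure (\<Pi>\<^sub>M i\<in>{t<..m}. D) (Q B))"
    using F by (intro sum.cong) auto
  also have "\<dots> \<le> (\<Sum>B\<in>Pow {1..n}. M.prob t (A B) * e)"
    using le by (intro sum_mono mult_left_mono) auto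
  also have "\<dots> = (\<Sum>B\<in>Pow {1..n}. M.prob t (A B)) * e"
    by (simp add: sum_distrib_right)
  also have "(\<Sum>B\<in>Pow {1..n}. M.prob t (A B)) = M.prob t (\<Union>B\<in>Pow {1..n}. A B)"
    by (rule M.finite_measure_finite_Union[symmetric])
      (use A in \<open>auto simp: disjoint_family_on_def A_def\<close>)
  also have "\<dots> * e \<le> 1 * e" using \<open>0 \<le> e\<close> by (intro mult_right_mono) auto
  finally show "M.prob m E \<le> e" by simp
qed

text \<open>The scheme guarantees free slots only almost surely. Requiring them here allows
  pointwise combinatorial arguments; \<open>prob_valid_le\<close> then discards a null set.\<close>

definition valid_run :: "nat \<Rightarrow> outcome \<Rightarrow> bool" where
  "valid_run T \<omega> \<longleftrightarrow> \<omega> \<in> space (run_space m D R) \<and>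
     (\<forall>i\<in>{1..m}. slot_of choice i \<omega> \<notin> occupied_before choice i \<omega> \<and> probe_complexity choice i \<omega> \<le> T)"

lemma inj_on_slot_of:
  assumes "valid_run T \<omega>"
  shows "inj_on (\<lambda>i. slot_of choice i \<omega>) {1..m}"
proof (rule linorder_inj_onI')
  fix i j assume ij: "i \<in> {1..m}" "j \<in> {1..m}" "i < j"
  then have "slot_of choice i \<omega> \<in> occupied_before choice j \<omega>" by (auto simp: occupied_before_def)
  then show "slot_of choice i \<omega> \<noteq> slot_of choice j \<omega>"
    using assms ij(2) unfolding valid_run_def by metis
qed

lemma card_occupied_before:
  assumes "valid_run T \<omega>" "t \<le> m"
  shows "card (occupied_before choice (Suc t) \<omega>) = t"
  unfolding occupied_before_def atLeastLessThanSuc_atLeastAtMost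
  by (subst card_image) (use inj_on_subset[OF inj_on_slot_of[OF assms(1)]] assms(2) in auto)

lemma slot_of_probe:
  assumes "valid_run T \<omega>" "i \<in> {1..m}"
  obtains j where "j \<in> {1..T}" "slot_of choice i \<omega> = snd \<omega> i j" "j = probe_complexity choice i \<omega>"
  using assms probe_complexity_ge_1[of \<omega> i] by (auto simp: valid_run_def slot_of_def)

lemma prob_valid_le:
  assumes "\<And>\<omega>. valid_run T \<omega> \<Longrightarrow> \<omega> \<in> E" "E \<in> sets (run_space m D R)"
  shows "measure (run_space m D R) {\<omega> \<in> space (run_space m D R). \<forall>i\<in>{1..m}. probe_complexity choice i \<omega> \<le> T}
    \<le> measure (run_space m D R) E"
proof -
  interpret M: prob_space "run_space m D R" by (rule prob_run_space)
  show ?thesis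
  proof (rule M.finite_measure_mono_AE[OF _ assms(2)])
    show "AE \<omega> in run_space m D R. \<omega> \<in> {\<omega> \<in> space (run_space m D R). \<forall>i\<in>{1..m}. probe_complexity choice i \<omega> \<le> T} \<longrightarrow> \<omega> \<in> E"
      using placed_in_free_slot by eventually_elim (use assms(1) in \<open>auto simp: valid_run_def\<close>)
  qed
qed

section \<open>Slots hit by the first \<open>T\<close> probes of one key\<close>

lemma sets_probe_in:
  assumes "p \<ge> 1"
  shows "{x \<in> space D. x p \<in> B} \<in> sets D"
proof -
  have "{x \<in> space D. x p \<in> B} = (\<lambda>x. x p) -` (B \<inter> {1..n}) \<inter> space D"
    using measurable_space[OF probe_measurable[OF assms]] by auto
  also have "\<dots> \<in> sets D"
    by (rule measurable_sets[OF probe_measurable[OF assms]]) simp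
  finally show ?thesis .
qed

definition hits :: "nat \<Rightarrow> nat \<Rightarrow> (nat \<Rightarrow> nat) set" where
  "hits T s = {x \<in> space D. \<exists>j\<in>{1..T}. x j = s}"

lemma sets_hits: "hits T s \<in> sets D"
  unfolding hits_def
  using sets_probe_in[of _ "{s}"] by (intro sets.sets_Collect_finite_Ex) auto

lemma card_hits_le:
  assumes "x \<in> space D" "finite S"
  shows "card {s \<in> S. x \<in> hits T s} \<le> T"
proof -
  have "{s \<in> S. x \<in> hits T s} \<subseteq> x ` {1..T}" by (auto simp: hits_def)
  then have "card {s \<in> S. x \<in> hits T s} \<le> card (x ` {1..T})" by (intro card_mono) auto
  also have "\<dots> \<le> T" using card_image_le[of "{1..T}" x] by simp
  finally show ?thesis .
qed

lemma sum_hits_le: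
  assumes "finite S"
  shows "(\<Sum>s\<in>S. measure D (hits T s)) \<le> real T"
  by (intro D.sum_prob_le assms sets_hits card_hits_le)

text \<open>One key hits at most \<open>T\<close> slots, hence at most \<open>T\<^sup>2\<close>
  ordered pairs of slots. This provides \<open>W\<close> for \<open>few_missed\<close>.\<close>

lemma sum_hits_Int_le:
  assumes "finite S"
  shows "(\<Sum>s\<in>S. \<Sum>s'\<in>S. measure D (hits T s \<inter> hits T s')) \<le> (real T)\<^sup>2"
proof -
  have "(\<Sum>p\<in>S \<times> S. measure D (hits T (fst p) \<inter> hits T (snd p))) \<le> real (T\<^sup>2)"
  proof (intro D.sum_prob_le sets.Int sets_hits)
    fix x assume x: "x \<in> space D"
    have "{p \<in> S \<times> S. x \<in> hits T (fst p) \<inter> hits T (snd p)}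
      = {s \<in> S. x \<in> hits T s} \<times> {s \<in> S. x \<in> hits T s}" by auto
    then show "card {p \<in> S \<times> S. x \<in> hits T (fst p) \<inter> hits T (snd p)} \<le> T\<^sup>2"
      using card_hits_le[OF x assms, of T]
      by (simp add: card_cartesian_product power2_eq_square mult_mono)
  qed (use assms in auto)
  then show ?thesis by (simp add: sum.cartesian_product split_def)
qed

text \<open>After \<open>t\<close> keys at least \<sigma> slots of \<open>L\<close> are free, and at
  least \<mu> of them are expected to be missed by all later keys and so to stay empty. A valid run
  leaves only \<open>n - m < \<mu> / 2\<close> slots empty, so it lies in the lower tail bounded by
  \<open>few_missed\<close>.\<close>

lemma prob_valid_le_of_rarely_hit:
  assumes t: "t \<le> m" and L: "L \<subseteq> {1..n}" "\<And>s. s \<in> L \<Longrightarrow> measure D (hits T s) \<le> a" "a \<le> 1"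
    and \<sigma>: "\<sigma> \<le> real (card L) - real t" and \<mu>: "\<mu> \<le> \<sigma> * (1 - a) ^ (m - t)" "real (n - m) < \<mu> / 2"
  shows "measure (run_space m D R) {\<omega> \<in> space (run_space m D R). \<forall>i\<in>{1..m}. probe_complexity choice i \<omega> \<le> T}
    \<le> 4 * (real (m - t) * (real T)\<^sup>2) / \<mu>\<^sup>2"
proof -
  let ?J = "{t<..m}" and ?M = "run_space m D R"
  let ?P = "PiM ?J (\<lambda>_. D)"
  have \<mu>0: "\<mu> > 0" using \<mu>(2) of_nat_0_le_iff[of "n - m", where 'a = real] by linarith
  \<comment> \<open>In valid runs exactly \<open>t\<close> slots are occupied, so any other
    \<open>B\<close> may get the empty event; the cardinality yields
    \<open>\<sigma> \<le> card (L - B)\<close>.\<close>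
  define Q where "Q B = (if card B = t then
      {h \<in> space ?P. real (card {s\<in>L - B. \<forall>i\<in>?J. h i \<notin> hits T s}) \<le> \<mu> / 2} else {})" for B
  have finL: "finite L" using L finite_subset by blast
  have Q: "Q B \<in> sets ?P" for B
    unfolding Q_def using sets_few_missed[OF prob_D, of ?J ?J "L - B" "hits T" "\<mu> / 2"] finL sets_hits by auto
  have Qle: "measure ?P (Q B) \<le> 4 * (real (m - t) * (real T)\<^sup>2) / \<mu>\<^sup>2" if B: "B \<subseteq> {1..n}" for B
  proof (cases "card B = t")
    case True
    have "card L \<le> card (L - B) + card B"
      by (metis card_Diff_subset_Int card_mono finite_Int diff_le_mono2 finL B finite_atLeastAtMost finite_subset inf_le2 le_diff_conv)
    then have \<sigma>': "\<sigma> \<le> real (card (L - B))" using True \<sigma> by linarith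
    have "\<mu> \<le> \<sigma> * (1 - a) ^ (m - t)" by fact
    also have "\<dots> \<le> real (card (L - B)) * (1 - a) ^ (m - t)"
      using \<sigma>' L by (intro mult_right_mono) auto
    also have "\<dots> \<le> (\<Sum>s\<in>L - B. (1 - measure D (hits T s)) ^ (m - t))"
    proof -
      have "(1 - a) ^ (m - t) \<le> (1 - measure D (hits T s)) ^ (m - t)" if "s \<in> L - B" for s
        using L(2)[of s] L(3) that by (intro power_mono) auto
      from sum_bounded_below[of "L - B", OF this] show ?thesis by simp
    qed
    finally show ?thesis
      using few_missed[OF prob_D, of ?J ?J "L - B" "hits T" "(real T)\<^sup>2" \<mu>] finL True sets_hits sum_hits_Int_le \<mu>0
      by (simp add: Q_def)
  next
    case False
    then show ?thesis by (simp add: Q_def)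
  qed
  define E where "E = {\<omega> \<in> space ?M. restrict (snd \<omega>) ?J \<in> Q (occupied_before choice (Suc t) \<omega>)}"
  have E: "E \<in> sets ?M" "measure ?M E \<le> 4 * (real (m - t) * (real T)\<^sup>2) / \<mu>\<^sup>2"
    unfolding E_def by (rule suffix_given_occupied[OF t Q Qle]; assumption)+
  have in_E: "\<omega> \<in> E" if v: "valid_run T \<omega>" for \<omega>
  proof -
    have \<omega>: "\<omega> \<in> space ?M" using v by (simp add: valid_run_def)
    let ?B = "occupied_before choice (Suc t) \<omega>" and ?B' = "occupied_before choice (Suc m) \<omega>"
    \<comment> \<open>A slot that is free after key \<open>t\<close> and missed afterwards is still
      free after key \<open>m\<close>.\<close>
    have "{s\<in>L - ?B. \<forall>i\<in>?J. restrict (snd \<omega>) ?J i \<notin> hits T s} \<subseteq> {1..n} - ?B'"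
    proof
      fix s assume s: "s \<in> {s\<in>L - ?B. \<forall>i\<in>?J. restrict (snd \<omega>) ?J i \<notin> hits T s}"
      have "s \<notin> ?B'"
      proof
        assume "s \<in> ?B'"
        then obtain i where i: "i \<in> {1..m}" "s = slot_of choice i \<omega>"
          by (auto simp: occupied_before_def atLeastLessThanSuc_atLeastAtMost)
        show False
        proof (cases "i \<le> t")
          case True
          then show ?thesis using s i by (auto simp: occupied_before_def)
        next
          case False
          from slot_of_probe[OF v i(1)] obtain j where "j \<in> {1..T}" "s = snd \<omega> i j"
            using i by metis
          then have "snd \<omega> i \<in> hits T s"
            using snd_in_space_D[OF \<omega> i(1)] by (auto simp: hits_def)
          then show ?thesis using s i False by auto
        qed
      qed
      then show "s \<in> {1..n} - ?B'" using s L by auto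
    qed
    then have "card {s\<in>L - ?B. \<forall>i\<in>?J. restrict (snd \<omega>) ?J i \<notin> hits T s} \<le> card ({1..n} - ?B')"
      by (intro card_mono) auto
    also have "\<dots> = n - m"
      using card_occupied_before[OF v] occupied_before_subset[OF \<omega>]
      by (subst card_Diff_subset) (auto intro: finite_subset)
    finally have "real (card {s\<in>L - ?B. \<forall>i\<in>?J. restrict (snd \<omega>) ?J i \<notin> hits T s}) \<le> \<mu> / 2"
      using \<mu>(2) by linarith
    moreover have "restrict (snd \<omega>) ?J \<in> space ?P"
      using snd_in_space_D[OF \<omega>] t by (auto simp: space_PiM)
    ultimately show ?thesis
      using \<omega> card_occupied_before[OF v t] by (simp add: E_def Q_def)
  qed
  show ?thesis
    using prob_valid_le[of T E, OF in_E E(1)] E(2) by linarith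
qed

section \<open>The bound in terms of the load\<close>

text \<open>Double counting over dyadic levels. Every level contributes at least
  \<open>n / 2 ^ (i + 2)\<close> slots times its threshold, which is \<open>l / 64\<close> whatever
  \<open>i\<close> is, while all hit probabilities together are at most \<open>T\<close>.\<close>

lemma many_often_hit_slots:
  assumes l: "l \<ge> 8" and n: "n > 0"
    and H: "\<And>i. i \<in> {1..nat \<lfloor>l / 4\<rfloor>} \<Longrightarrow>
      real (card {s \<in> {1..n}. measure D (hits T s) > 2 ^ i * l / (16 * real n)}) \<ge> real n / 2 ^ (i + 2)"
  shows "real T \<ge> l\<^sup>2 / 1024"
proof -
  define I where "I = nat \<lfloor>l / 4\<rfloor>"
  define h where "h s = measure D (hits T s)" for s
  define \<theta> where "\<theta> i = 2 ^ i * l / (16 * real n)" for i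
  \<comment> \<open>The thresholds below \<open>h s\<close> grow geometrically, so a slot counted at
    several levels is charged only \<open>2 * h s\<close>.\<close>
  have per_slot: "(\<Sum>i\<in>{1..I}. if h s > \<theta> i then \<theta> i else 0) \<le> 2 * h s" for s
  proof -
    define A where "A = {i\<in>{1..I}. h s > \<theta> i}"
    have "(\<Sum>i\<in>A. (2::real) ^ i) \<le> 2 * (16 * real n * h s / l)"
      using l n by (intro sum_powers_of_two_less) (auto simp: A_def h_def \<theta>_def field_simps)
    then have "(\<Sum>i\<in>A. (2::real) ^ i) * (l / (16 * real n)) \<le> 2 * (16 * real n * h s / l) * (l / (16 * real n))"
      using l by (intro mult_right_mono) auto
    also have "\<dots> = 2 * h s" using l n by simp
    finally have "(\<Sum>i\<in>A. \<theta> i) \<le> 2 * h s" by (simp add: \<theta>_def sum_distrib_right sum_divide_distrib)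
    moreover have "(\<Sum>i\<in>{1..I}. if h s > \<theta> i then \<theta> i else 0) = (\<Sum>i\<in>A. \<theta> i)"
      unfolding A_def by (rule sum.inter_filter[symmetric]) simp
    ultimately show ?thesis by simp
  qed
  have "real I * (l / 64) = (\<Sum>i\<in>{1..I}. real n / 2 ^ (i + 2) * \<theta> i)"
    using n by (simp add: \<theta>_def power_add field_simps)
  also have "\<dots> \<le> (\<Sum>i\<in>{1..I}. real (card {s \<in> {1..n}. h s > \<theta> i}) * \<theta> i)"
    using H l by (intro sum_mono mult_right_mono) (auto simp: h_def \<theta>_def I_def)
  also have "\<dots> = (\<Sum>i\<in>{1..I}. \<Sum>s\<in>{1..n}. if h s > \<theta> i then \<theta> i else 0)"
    by (intro sum.cong refl) (simp add: sum.If_cases Int_def)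
  also have "\<dots> = (\<Sum>s\<in>{1..n}. \<Sum>i\<in>{1..I}. if h s > \<theta> i then \<theta> i else 0)"
    by (rule sum.swap)
  also have "\<dots> \<le> (\<Sum>s\<in>{1..n}. 2 * h s)" by (intro sum_mono per_slot)
  also have "\<dots> \<le> 2 * real T"
    using sum_hits_le[of "{1..n}" T] by (simp add: h_def sum_distrib_left[symmetric])
  finally have "real I * (l / 64) \<le> 2 * real T" .
  \<comment> \<open>Rounding \<open>l / 4\<close> down costs at most half of it because
    \<open>l \<ge> 8\<close>.\<close>
  moreover have "l / 8 \<le> real I" using l unfolding I_def by linarith
  then have "l / 8 * (l / 64) \<le> real I * (l / 64)" using l by (intro mult_right_mono) auto
  ultimately show ?thesis by (simp add: power2_eq_square)
qed

text \<open>By \<open>many_often_hit_slots\<close> some level \<open>i\<close> fails. Before the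
  last \<open>K\<close> keys, about \<open>n / 2 ^ i\<close> of them, enough free slots are rarely
  hit that the expected number left empty exceeds twice \<open>\<delta> * n\<close>.\<close>

lemma prob_valid_less_half_load:
  assumes \<delta>: "0 < \<delta>" "\<delta> < 1" "real m = real n * (1 - \<delta>)"
    and l: "l = log 2 (1 / \<delta>)" "l \<ge> 8"
    and y: "2 powr (- l / 4) < 1/8" "l * 2 powr (- l / 4) < 8" "l ^ 4 * 2 powr (- l / 4) < 1"
    and n: "n > 0" and T: "real T < l\<^sup>2 / 1024"
  shows "measure (run_space m D R) {\<omega> \<in> space (run_space m D R). \<forall>i\<in>{1..m}. probe_complexity choice i \<omega> \<le> T} < 1/2"
proof -
  \<comment> \<open>\<open>y\<close> is the fourth root of \<open>\<delta>\<close>\<close>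
  define y where "y = 2 powr (- l / 4)"
  have y0: "0 < y" "y < 1/8" "l * y < 8" "l ^ 4 * y < 1" using y by (simp_all add: y_def)
  have \<delta>_eq: "\<delta> = y ^ 4"
  proof -
    have "y ^ 4 = 2 powr (- l)" by (simp add: y_def powr_power)
    also have "\<dots> = \<delta>" using \<delta> by (simp add: l powr_minus)
    finally show ?thesis ..
  qed
  have nm: "real n - real m = real n * y ^ 4" using \<delta> by (simp add: \<delta>_eq algebra_simps)
  then have "m < n" using n y0 by (smt (verit) mult_pos_pos of_nat_0_less_iff of_nat_less_iff zero_less_power)
  \<comment> \<open>At least one slot stays empty, so \<open>\<delta> * n \<ge> 1\<close>; this is
    how \<open>n\<close> is bounded below in terms of \<open>y\<close>.\<close>
  then have n1: "1 \<le> real n * y ^ 4" using nm by linarith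
  have "\<not> l\<^sup>2 / 1024 \<le> real T" using T by simp
  then obtain i where i: "i \<in> {1..nat \<lfloor>l / 4\<rfloor>}"
    and few: "real (card {s \<in> {1..n}. measure D (hits T s) > 2 ^ i * l / (16 * real n)}) < real n / 2 ^ (i + 2)"
    using many_often_hit_slots[OF l(2) n, of T] by (meson not_le)
  \<comment> \<open>Levels stop at \<open>l / 4\<close> precisely to ensure
    \<open>p * y \<le> 1\<close>.\<close>
  define p where "p = (2::real) ^ i"
  have p: "p \<ge> 2" "p * y \<le> 1"
  proof -
    have "(2::real) ^ 1 \<le> 2 ^ i" using i by (intro power_increasing) auto
    then show "p \<ge> 2" by (simp add: p_def)
    have "real i \<le> l / 4" using i l by (auto simp: le_nat_floor le_nat_iff le_floor_iff)
    then have "p \<le> 2 powr (l / 4)" by (simp add: p_def powr_realpow[symmetric])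
    then have "p * y \<le> 2 powr (l / 4) * y" using y0 by (intro mult_right_mono) auto
    then show "p * y \<le> 1" by (simp add: y_def powr_minus)
  qed
  define K where "K = n div 2 ^ i"
  have K_le: "real K \<le> real n / p"
    by (simp add: K_def p_def) (metis of_nat_numeral of_nat_power of_nat_div_le_of_nat)
  have np: "2 * p \<le> real n"
  proof -
    have "2 * p * y \<le> real n * y"
    proof -
      have "y ^ 3 \<le> 1 / 8" using y0 power_decreasing[of 1 3 y] by simp
      then have "real n * y * y ^ 3 \<le> real n * y * (1/8)" using y0 by (intro mult_left_mono) auto
      then have "8 \<le> real n * y" using n1 by (simp add: power_eq_if algebra_simps)
      then show ?thesis using p by linarith
    qed
    then show ?thesis using y0 by simp
  qed
  have K_ge: "real n / (2 * p) \<le> real K"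
  proof -
    have "real n / p - 1 \<le> real K"
    proof -
      have "n < (K + 1) * 2 ^ i"
        using dividend_less_div_times[of "2 ^ i" n] by (simp add: K_def algebra_simps)
      then have "real n < real ((K + 1) * 2 ^ i)" by (simp only: of_nat_less_iff)
      then show ?thesis using p by (simp add: p_def field_simps)
    qed
    moreover have "1 \<le> real n / (2 * p)" using np p by (simp add: field_simps)
    moreover have "real n / p = real n / (2 * p) + real n / (2 * p)" by simp
    ultimately show ?thesis by linarith
  qed
  have Km: "K \<le> m"
  proof -
    have "y ^ 4 \<le> 1 / 8" using y0 power_decreasing[of 1 4 y] by simp
    then have "real n * y ^ 4 \<le> real n * (1/8)" by (intro mult_left_mono) auto
    moreover have "real n / p \<le> real n / 2" using p by (intro divide_left_mono) auto
    ultimately show ?thesis using nm K_le by linarith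
  qed
  define H where "H = {s \<in> {1..n}. measure D (hits T s) > p * l / (16 * real n)}"
  define a where "a = p * l / (16 * real n)"
  have a0: "0 \<le> a" "a \<le> 1/2"
  proof -
    show "0 \<le> a" using p l by (simp add: a_def)
    have "p * l * y ^ 2 = (p * y) * (l * y)" by (simp add: power2_eq_square)
    also have "\<dots> \<le> 1 * 8" using p y0 l(2) by (intro mult_mono) auto
    also have "1 * 8 \<le> 8 * (real n * y ^ 4)" using n1 by simp
    also have "\<dots> = 8 * real n * y\<^sup>2 * y\<^sup>2" by (simp add: power_eq_if)
    also have "\<dots> \<le> 8 * real n * y\<^sup>2 * 1" using y0 by (intro mult_left_mono) (auto simp: power_le_one)
    finally have "p * l \<le> 8 * real n" using y0 by simp
    then show "a \<le> 1/2" using n by (simp add: a_def field_simps)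
  qed
  \<comment> \<open>Since \<open>a * K \<le> l / 16\<close>, a slot is missed with probability at
    least \<open>exp (- l / 8)\<close>, and this is at least \<open>y\<close> because
    \<open>ln 2 \<ge> 1/2\<close>.\<close>
  have miss: "y \<le> (1 - a) ^ K"
  proof -
    have "a * real K \<le> a * (real n / p)" using a0 K_le by (intro mult_left_mono) auto
    also have "\<dots> = l / 16" using n p by (simp add: a_def)
    finally have "- l / 8 \<le> - 2 * a * real K" by simp
    moreover have "- l / 4 * ln 2 \<le> - l / 8"
      using ln2_ge_two_thirds l mult_left_mono[of "1/2" "ln 2" l] by simp
    ultimately have "exp (- l / 4 * ln 2) \<le> exp (- 2 * a * real K)" by simp
    also have "\<dots> \<le> (1 - a) ^ K" using a0 by (rule one_minus_power_ge_exp)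
    finally show ?thesis by (simp add: y_def powr_def)
  qed
  \<comment> \<open>At least \<open>K \<ge> n / (2 * p)\<close> slots are free before the last
    \<open>K\<close> keys and fewer than half of that bound are often hit, which leaves
    \<sigma>.\<close>
  define \<sigma> where "\<sigma> = real n / (4 * p)"
  have cardH: "real (card H) < \<sigma>"
    using few by (simp add: H_def \<sigma>_def p_def power_add)
  have H_sub: "H \<subseteq> {1..n}" by (auto simp: H_def)
  have cardL: "real (card ({1..n} - H)) = real n - real (card H)"
    using H_sub card_mono[OF _ H_sub] by (subst card_Diff_subset) (auto intro: finite_subset)
  have \<mu>_large: "real (n - m) < \<sigma> * y / 2"
  proof -
    have "8 * y ^ 3 * p \<le> 8 * y ^ 2"
      using mult_left_mono[OF p(2), of "8 * y\<^sup>2"] by (simp add: power_eq_if algebra_simps)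
    moreover have "y\<^sup>2 \<le> (1/8)\<^sup>2" using y0 by (intro power_mono) auto
    ultimately have "8 * y ^ 3 * p < 1" by (simp add: power_divide)
    then have "real n * y * (8 * y ^ 3 * p) < real n * y * 1"
      using n y0 by (intro mult_strict_left_mono) auto
    then have "real n * y ^ 4 < \<sigma> * y / 2"
      using p by (simp add: \<sigma>_def field_simps power_eq_if)
    then show ?thesis using nm \<open>m < n\<close> by (simp add: of_nat_diff)
  qed
  have "measure (run_space m D R) {\<omega> \<in> space (run_space m D R). \<forall>i\<in>{1..m}. probe_complexity choice i \<omega> \<le> T}
    \<le> 4 * (real (m - (m - K)) * (real T)\<^sup>2) / (\<sigma> * y)\<^sup>2"
  proof (rule prob_valid_le_of_rarely_hit[where L = "{1..n} - H" and a = a and \<sigma> = \<sigma>])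
    have "\<sigma> + \<sigma> \<le> real K" using K_ge by (simp add: \<sigma>_def)
    then show "\<sigma> \<le> real (card ({1..n} - H)) - real (m - K)"
      using cardH cardL nm Km \<open>m < n\<close> by (simp add: of_nat_diff)
    have "\<sigma> * y \<le> \<sigma> * (1 - a) ^ K" using miss p by (intro mult_left_mono) (auto simp: \<sigma>_def)
    then show "\<sigma> * y \<le> \<sigma> * (1 - a) ^ (m - (m - K))" using Km by simp
    show "a \<le> 1" using a0 by linarith
  qed (use \<mu>_large in \<open>auto simp: H_def a_def\<close>)
  \<comment> \<open>The claim reduces to \<open>128 * T\<^sup>2 * p < n * y\<^sup>2\<close>.
    Multiplied by \<open>y\<^sup>2\<close> it follows from \<open>p * y \<le> 1\<close>,
    \<open>128 * T\<^sup>2 * y < 1\<close> and \<open>n * y ^ 4 \<ge> 1\<close>.\<close>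
  also have "\<dots> < 1/2"
  proof -
    have "(real T)\<^sup>2 \<le> (l\<^sup>2 / 1024)\<^sup>2" using T by (intro power_mono) auto
    then have "(real T)\<^sup>2 * y \<le> (l\<^sup>2 / 1024)\<^sup>2 * y" using y0 by (intro mult_right_mono) auto
    also have "\<dots> = l ^ 4 * y / 1024 ^ 2" by (simp add: power_divide power_mult[symmetric])
    also have "\<dots> < 1 / 1024 ^ 2" using y0 by (intro divide_strict_right_mono) auto
    finally have T_y: "128 * (real T)\<^sup>2 * y < 1" by simp
    have "128 * (real T)\<^sup>2 * p * y ^ 2 \<le> 128 * (real T)\<^sup>2 * y"
      using mult_left_mono[OF p(2), of "128 * (real T)\<^sup>2 * y"] y0
      by (simp add: power_eq_if algebra_simps)
    also have "\<dots> < real n * y ^ 4" using T_y n1 by linarith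
    finally have "(128 * (real T)\<^sup>2 * p) * y\<^sup>2 < (real n * y\<^sup>2) * y\<^sup>2" by (simp add: power_eq_if algebra_simps)
    then have *: "128 * (real T)\<^sup>2 * p < real n * y\<^sup>2" using y0 by simp
    have "4 * (real K * (real T)\<^sup>2) \<le> 4 * (real n / p * (real T)\<^sup>2)"
      using K_le by (intro mult_left_mono mult_right_mono) auto
    also have "\<dots> < (\<sigma> * y)\<^sup>2 / 2"
      using mult_strict_left_mono[OF *, of "real n"] n p by (simp add: \<sigma>_def field_simps power_eq_if)
    finally show ?thesis using Km n p y0 by (simp add: \<sigma>_def field_simps)
  qed
  finally show ?thesis .
qed

section \<open>The doubly logarithmic bound\<close>

definition probes_in :: "nat set \<Rightarrow> nat set \<Rightarrow> (nat \<Rightarrow> nat) set" where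
  "probes_in J B = {x \<in> space D. \<forall>p\<in>J. x p \<in> B}"

lemma sets_probes_in:
  assumes "J \<subseteq> {1..T}"
  shows "probes_in J B \<in> sets D"
  unfolding probes_in_def
  by (intro sets.sets_Collect_finite_All sets_probe_in) (use assms finite_subset in auto)

lemma sets_probes_in_probe_eq:
  assumes "J \<subseteq> {1..T}" "p \<ge> 1"
  shows "{x \<in> probes_in J B. x p = s} \<in> sets D"
proof -
  have eq: "{x \<in> probes_in J B. x p = s} = probes_in J B \<inter> {x \<in> space D. x p \<in> {s}}"
    by (auto simp: probes_in_def)
  show ?thesis
    unfolding eq by (rule sets.Int[OF sets_probes_in[OF assms(1)] sets_probe_in[OF assms(2)]])
qed

text \<open>The threshold is such that within the event \<open>probes_in J B\<close>, of probability at least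
  \<open>g\<close>, all light values together cost at most \<open>g/2\<close>. A slot occupied through a heavy value then adds
  at least the threshold to the probability of \<open>probes_in (insert p J) B'\<close>, so counting slots suffices.\<close>

definition heavy :: "nat \<Rightarrow> real \<Rightarrow> nat set \<Rightarrow> nat set \<Rightarrow> nat \<Rightarrow> nat set" where
  "heavy T g J B p = {s. measure D {x \<in> probes_in J B. x p = s} > g / (2 * real T * real n)}"

text \<open>All indices up to \<open>T\<close> are required to be heavy, so that whichever one the
  algorithm picks is.\<close>

definition heavy_probes :: "nat \<Rightarrow> real \<Rightarrow> nat set \<Rightarrow> nat set \<Rightarrow> (nat \<Rightarrow> nat) set" where
  "heavy_probes T g J B = {x \<in> probes_in J B. \<forall>p\<in>{1..T}. x p \<in> heavy T g J B p}"

lemma sets_heavy_probes: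
  assumes "J \<subseteq> {1..T}"
  shows "heavy_probes T g J B \<in> sets D"
proof -
  have "heavy_probes T g J B = probes_in J B \<inter> {x \<in> space D. \<forall>p\<in>{1..T}. x p \<in> heavy T g J B p}"
    by (auto simp: heavy_probes_def probes_in_def)
  moreover have "{x \<in> space D. \<forall>p\<in>{1..T}. x p \<in> heavy T g J B p} \<in> sets D"
    by (intro sets.sets_Collect_finite_All sets_probe_in) auto
  ultimately show ?thesis using sets_probes_in[OF assms] by auto
qed

text \<open>Union bound over the at most \<open>T * n\<close> light pairs of index and slot, each of
  probability at most \<open>g / (2 * T * n)\<close>.\<close>

lemma measure_heavy_probes_ge:
  assumes J: "J \<subseteq> {1..T}" and g: "0 < g" "g \<le> measure D (probes_in J B)"
    and T: "T \<ge> 1" and n: "n \<ge> 1"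
  shows "g / 2 \<le> measure D (heavy_probes T g J B)"
proof -
  let ?E = "probes_in J B" and ?G = "heavy_probes T g J B"
  let ?S = "{1..T} \<times> {1..n}"
  define F where "F q = (if snd q \<in> heavy T g J B (fst q) then {} else {x \<in> ?E. x (fst q) = snd q})" for q
  have F: "F q \<in> sets D" "measure D (F q) \<le> g / (2 * real T * real n)" if "q \<in> ?S" for q
    using sets_probes_in_probe_eq[OF J, of "fst q"] that g
    by (auto simp: F_def heavy_def)
  have "?E - ?G \<subseteq> (\<Union>q\<in>?S. F q)"
  proof
    fix x assume x: "x \<in> ?E - ?G"
    then obtain p where p: "p \<in> {1..T}" "x p \<notin> heavy T g J B p" by (auto simp: heavy_probes_def)
    have "x p \<in> {1..n}" using x p by (auto simp: probes_in_def space_D PiE_iff)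
    then have "(p, x p) \<in> ?S" "x \<in> F (p, x p)" using p x by (auto simp: F_def)
    then show "x \<in> (\<Union>q\<in>?S. F q)" by blast
  qed
  then have "measure D (?E - ?G) \<le> measure D (\<Union>q\<in>?S. F q)"
    using F by (intro D.finite_measure_mono sets.finite_UN) auto
  also have "\<dots> \<le> (\<Sum>q\<in>?S. measure D (F q))"
    using F by (intro D.finite_measure_subadditive_finite) auto
  also have "\<dots> \<le> (\<Sum>q\<in>?S. g / (2 * real T * real n))" using F by (intro sum_mono)
  also have "\<dots> = g / 2" using T n by (simp add: card_cartesian_product)
  finally have "measure D (?E - ?G) \<le> g / 2" .
  moreover have "measure D (?E - ?G) = measure D ?E - measure D ?G"
    using sets_probes_in[OF J] sets_heavy_probes[OF J]
    by (intro D.finite_measure_Diff) (auto simp: heavy_probes_def)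
  ultimately show ?thesis using g by simp
qed

lemma occupied_before_mono:
  "t \<le> t' \<Longrightarrow> occupied_before choice (Suc t) \<omega> \<subseteq> occupied_before choice (Suc t') \<omega>"
  by (auto simp: occupied_before_def)

text \<open>Pointwise in the run: the counted keys must use indices outside \<open>J\<close>, some
  \<open>p\<close> serves more than \<open>K * g / (4 * T)\<close> of them, and their distinct slots
  each add at least \<open>g / (2 * T * n)\<close>.\<close>

lemma heavy_probes_extend:
  assumes v: "valid_run T \<omega>" and J: "J \<subseteq> {1..T}" and tK: "t + K \<le> m" and K: "K \<ge> 1"
    and g: "0 < g" and T: "T \<ge> 1" and n: "n \<ge> 1"
  defines "B \<equiv> occupied_before choice (Suc t) \<omega>"
  assumes many: "real (card {i \<in> {t<..t + K}. snd \<omega> i \<in> heavy_probes T g J B}) > real K * g / 4"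
  shows "\<exists>p\<in>{1..T} - J. real K * g\<^sup>2 / (8 * (real T)\<^sup>2 * real n)
    \<le> measure D (probes_in (insert p J) (occupied_before choice (Suc (t + K)) \<omega>))"
proof -
  define N where "N = {i \<in> {t<..t + K}. snd \<omega> i \<in> heavy_probes T g J B}"
  define pos where "pos i = probe_complexity choice i \<omega>" for i
  have \<omega>: "\<omega> \<in> space (run_space m D R)" using v by (simp add: valid_run_def)
  have N: "i \<in> {1..m}" "t < i" "i \<le> t + K" "snd \<omega> i \<in> heavy_probes T g J B" if "i \<in> N" for i
    using that tK by (auto simp: N_def)
  have finN: "finite N" by (simp add: N_def)
  have pos: "pos i \<in> {1..T}" "slot_of choice i \<omega> = snd \<omega> i (pos i)" if "i \<in> N" for i
    using slot_of_probe[OF v N(1)[OF that]] by (metis pos_def)+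
  \<comment> \<open>The probes with index in \<open>J\<close> point into \<open>B\<close>, which was
    occupied before key \<open>i\<close> arrived.\<close>
  have pos_J: "pos i \<notin> J" if i: "i \<in> N" for i
  proof
    assume "pos i \<in> J"
    then have "slot_of choice i \<omega> \<in> B"
      using N(4)[OF i] pos(2)[OF i] by (auto simp: heavy_probes_def probes_in_def)
    moreover have "B \<subseteq> occupied_before choice i \<omega>"
      using N(2)[OF i] by (auto simp: B_def occupied_before_def)
    ultimately show False using v N(1)[OF i] by (auto simp: valid_run_def)
  qed
  \<comment> \<open>Pigeonhole over the \<open>T\<close> possible indices.\<close>
  obtain p where p: "p \<in> {1..T}" "real (card {i \<in> N. pos i = p}) > real K * g / (4 * real T)"
  proof (rule ccontr)
    assume "\<not> thesis"
    with that have le: "real (card {i \<in> N. pos i = p}) \<le> real K * g / (4 * real T)" if "p \<in> {1..T}" for p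
      using \<open>p \<in> {1..T}\<close> by (meson not_le)
    have "real (card N) = (\<Sum>p\<in>{1..T}. real (card {i \<in> N. pos i = p}))"
    proof -
      have "card N = (\<Sum>p\<in>{1..T}. card {i \<in> N. pos i = p})"
        using sum.group[of N "{1..T}" pos "\<lambda>_. 1::nat"] pos(1) finN by (simp add: image_subset_iff)
      then show ?thesis by simp
    qed
    also have "\<dots> \<le> (\<Sum>p\<in>{1..T}. real K * g / (4 * real T))" by (intro sum_mono le)
    also have "\<dots> = real K * g / 4" using T by simp
    finally show False using many by (simp add: N_def)
  qed
  define N' where "N' = {i \<in> N. pos i = p}"
  define S where "S = (\<lambda>i. slot_of choice i \<omega>) ` N'"
  have "N' \<noteq> {}"
  proof
    assume "N' = {}"
    then have "real K * g / (4 * real T) < 0" using p(2) by (simp add: N'_def[symmetric])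
    then show False using g by (simp add: divide_less_0_iff mult_less_0_iff)
  qed
  then have "p \<notin> J" using pos_J by (auto simp: N'_def)
  have cardS: "card S = card N'"
    unfolding S_def
    by (intro card_image inj_on_subset[OF inj_on_slot_of[OF v]]) (use N in \<open>auto simp: N'_def\<close>)
  let ?E = "\<lambda>s. {x \<in> probes_in J B. x p = s}"
  have finS: "finite S" using finN by (simp add: S_def N'_def)
  have heavyS: "g / (2 * real T * real n) \<le> measure D (?E s)" if "s \<in> S" for s
  proof -
    obtain i where "i \<in> N" "pos i = p" "s = snd \<omega> i p"
      using \<open>s \<in> S\<close> pos(2) by (auto simp: S_def N'_def)
    then have "s \<in> heavy T g J B p" using N(4) p(1) by (auto simp: heavy_probes_def)
    then show ?thesis by (simp add: heavy_def)
  qed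
  have S_occ: "S \<subseteq> occupied_before choice (Suc (t + K)) \<omega>"
    unfolding S_def occupied_before_def
    by (intro image_mono) (use N(1,3) in \<open>force simp: N'_def atLeastLessThanSuc_atLeastAtMost\<close>)
  have "real K * g\<^sup>2 / (8 * (real T)\<^sup>2 * real n) = real K * g / (4 * real T) * (g / (2 * real T * real n))"
    by (simp add: power2_eq_square)
  also have "\<dots> \<le> real (card S) * (g / (2 * real T * real n))"
    using p(2) g cardS by (intro mult_right_mono) (auto simp: N'_def)
  also have "\<dots> \<le> (\<Sum>s\<in>S. measure D (?E s))"
    using sum_bounded_below[of S "g / (2 * real T * real n)" "\<lambda>s. measure D (?E s)"] heavyS by simp
  also have "\<dots> = measure D (\<Union>s\<in>S. ?E s)"
    by (rule D.finite_measure_finite_Union[symmetric])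
      (use finS p sets_probes_in_probe_eq[OF J] in \<open>auto simp: disjoint_family_on_def\<close>)
  also have "\<dots> \<le> measure D (probes_in (insert p J) (occupied_before choice (Suc (t + K)) \<omega>))"
  proof (rule D.finite_measure_mono)
    show "(\<Union>s\<in>S. ?E s) \<subseteq> probes_in (insert p J) (occupied_before choice (Suc (t + K)) \<omega>)"
      using S_occ occupied_before_mono[of t "t + K" \<omega>] by (auto simp: probes_in_def B_def)
    show "probes_in (insert p J) (occupied_before choice (Suc (t + K)) \<omega>) \<in> sets D"
      using J p by (intro sets_probes_in[of _ T]) auto
  qed
  finally show ?thesis using p(1) \<open>p \<notin> J\<close> by blast
qed

text \<open>The invariant of the rounds. With the occupied set of \<omega> held fixed, the measure
  under \<open>D\<close> is the conditional probability for a fresh key; \<open>J\<close> may depend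
  on \<omega>.\<close>

definition occupied_probes :: "nat \<Rightarrow> nat \<Rightarrow> nat \<Rightarrow> real \<Rightarrow> outcome \<Rightarrow> bool" where
  "occupied_probes T t j g \<omega> \<longleftrightarrow> (\<exists>J\<subseteq>{1..T}. card J = j \<and>
     g \<le> measure D (probes_in J (occupied_before choice (Suc t) \<omega>)))"

text \<open>The exceptional event is that too few of the next \<open>K\<close> keys lie in
  \<open>heavy_probes\<close>; \<open>few_in_set\<close> with success probability
  \<open>g / 2\<close> bounds it, and outside it \<open>heavy_probes_extend\<close> applies.\<close>

lemma round_event:
  assumes tK: "t + K \<le> m" and K: "K \<ge> 1" and g: "0 < g" and T: "T \<ge> 1" and n: "n \<ge> 1"
  obtains E where "E \<in> sets (run_space m D R)" "measure (run_space m D R) E \<le> 8 / (real K * g)"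
    "\<And>\<omega>. valid_run T \<omega> \<Longrightarrow> occupied_probes T t j g \<omega> \<Longrightarrow> \<omega> \<notin> E \<Longrightarrow>
       occupied_probes T (t + K) (Suc j) (real K * g\<^sup>2 / (8 * (real T)\<^sup>2 * real n)) \<omega>"
proof -
  let ?I = "{t<..t + K}" and ?P = "\<Pi>\<^sub>M i\<in>{t<..m}. D"
  define ok where "ok B J \<longleftrightarrow> J \<subseteq> {1..T} \<and> card J = j \<and> g \<le> measure D (probes_in J B)" for B J
  \<comment> \<open>Choosing \<open>J\<close> as a function of the occupied set fixes the target set
    of the later keys, as \<open>suffix_given_occupied\<close> demands.\<close>
  define W where "W B = (SOME J. ok B J)" for B
  define Q where "Q B = (if \<exists>J. ok B J then
      {h \<in> space ?P. real (card {i\<in>?I. h i \<in> heavy_probes T g (W B) B}) \<le> real (card ?I) * (g / 2) / 2} else {})" for B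
  have W: "ok B (W B)" if "\<exists>J. ok B J" for B
    unfolding W_def using that by (rule someI_ex)
  have I: "?I \<subseteq> {t<..m}" "?I \<noteq> {}" "finite {t<..m}" using tK K by auto
  have Q: "Q B \<in> sets ?P" "measure ?P (Q B) \<le> 8 / (real K * g)" for B
  proof -
    have "Q B \<in> sets ?P \<and> measure ?P (Q B) \<le> 8 / (real K * g)"
    proof (cases "\<exists>J. ok B J")
      case True
      note W = W[OF True, unfolded ok_def]
      have H: "heavy_probes T g (W B) B \<in> sets D" "g / 2 \<le> measure D (heavy_probes T g (W B) B)"
        using sets_heavy_probes measure_heavy_probes_ge W g T n by auto
      have Q_eq: "Q B = {h \<in> space ?P. real (card {i\<in>?I. h i \<in> heavy_probes T g (W B) B}) \<le> real (card ?I) * (g / 2) / 2}"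
        using True by (simp only: Q_def if_True)
      have "measure ?P (Q B) \<le> 4 / (real (card ?I) * (g / 2))"
        unfolding Q_eq by (rule few_in_set[OF prob_D I(3) I(1) H _ I(2)]) (use g in simp)
      also have "\<dots> = 8 / (real K * g)" using K g by simp
      finally show ?thesis
        unfolding Q_eq using sets_few_in_set[OF prob_D I(3) I(1) H(1)] by blast
    next
      case False
      then show ?thesis using g by (simp add: Q_def)
    qed
    then show "Q B \<in> sets ?P" "measure ?P (Q B) \<le> 8 / (real K * g)" by auto
  qed
  define E where "E = {\<omega> \<in> space (run_space m D R). restrict (snd \<omega>) {t<..m} \<in> Q (occupied_before choice (Suc t) \<omega>)}"
  have t: "t \<le> m" using tK by simp
  show thesis
  proof (rule that[of E])
    show "E \<in> sets (run_space m D R)" "measure (run_space m D R) E \<le> 8 / (real K * g)"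
      unfolding E_def by (rule suffix_given_occupied[OF t Q]; assumption)+
  next
    fix \<omega> assume v: "valid_run T \<omega>" and occ: "occupied_probes T t j g \<omega>" and "\<omega> \<notin> E"
    let ?B = "occupied_before choice (Suc t) \<omega>"
    have \<omega>: "\<omega> \<in> space (run_space m D R)" using v by (simp add: valid_run_def)
    have ex: "\<exists>J. ok ?B J" using occ by (auto simp: occupied_probes_def ok_def)
    note W = W[OF ex, unfolded ok_def]
    have "restrict (snd \<omega>) {t<..m} \<in> space ?P"
      using snd_in_space_D[OF \<omega>] by (auto simp: space_PiM)
    moreover have "restrict (snd \<omega>) {t<..m} \<notin> Q ?B" using \<open>\<omega> \<notin> E\<close> \<omega> by (simp add: E_def)
    ultimately have "real (card {i\<in>?I. restrict (snd \<omega>) {t<..m} i \<in> heavy_probes T g (W ?B) ?B}) > real K * g / 4"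
      using ex by (simp add: Q_def not_le)
    also have "{i\<in>?I. restrict (snd \<omega>) {t<..m} i \<in> heavy_probes T g (W ?B) ?B}
      = {i\<in>?I. snd \<omega> i \<in> heavy_probes T g (W ?B) ?B}" using I(1) by auto
    finally obtain p where p: "p \<in> {1..T} - W ?B"
      "real K * g\<^sup>2 / (8 * (real T)\<^sup>2 * real n) \<le> measure D (probes_in (insert p (W ?B)) (occupied_before choice (Suc (t + K)) \<omega>))"
      using heavy_probes_extend[OF v _ tK K g T n, of "W ?B"] W by blast
    have "finite (W ?B)" using W finite_subset by blast
    then have "insert p (W ?B) \<subseteq> {1..T}" "card (insert p (W ?B)) = Suc j" using p W by auto
    then show "occupied_probes T (t + K) (Suc j) (real K * g\<^sup>2 / (8 * (real T)\<^sup>2 * real n)) \<omega>"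
      using p(2) unfolding occupied_probes_def by blast
  qed
qed

text \<open>Without an exceptional event, \<open>T + 1\<close> rounds would produce
  \<open>T + 1\<close> distinct indices in \<open>{1..T}\<close>. So every valid run meets one of
  them, and a union bound finishes.\<close>

lemma prob_valid_le_rounds:
  assumes K: "K \<ge> 1" "Suc T * K \<le> m" and T: "T \<ge> 1" and n: "n \<ge> 1"
    and \<kappa>: "0 < \<kappa>" "\<kappa> \<le> 1" "\<kappa> \<le> real K / (8 * (real T)\<^sup>2 * real n)"
  shows "measure (run_space m D R) {\<omega> \<in> space (run_space m D R). \<forall>i\<in>{1..m}. probe_complexity choice i \<omega> \<le> T}
    \<le> real (Suc T) * (8 / (real K * \<kappa> ^ (2 ^ T)))"
proof -
  interpret M: prob_space "run_space m D R" by (rule prob_run_space)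
  let ?M = "run_space m D R"
  \<comment> \<open>The solution of \<open>g 0 = 1\<close> and
    \<open>g (Suc j) = \<kappa> * (g j)\<^sup>2\<close>.\<close>
  define g where "g j = \<kappa> ^ (2 ^ j - 1)" for j :: nat
  have g0: "g j > 0" for j using \<kappa> by (simp add: g_def)
  have g_Suc: "g (Suc j) = \<kappa> * (g j)\<^sup>2" for j
  proof -
    have "2 ^ Suc j - 1 = Suc (2 * (2 ^ j - 1))" 
    by (cases "2 ^ j :: nat") simp_all
    then show ?thesis by (simp add: g_def power_mult[symmetric] mult.commute)
  qed
  have "\<exists>E. E \<in> sets ?M \<and> measure ?M E \<le> 8 / (real K * g j) \<and>
      (\<forall>\<omega>. valid_run T \<omega> \<longrightarrow> occupied_probes T (j * K) j (g j) \<omega> \<longrightarrow> \<omega> \<notin> E \<longrightarrow>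
       occupied_probes T (j * K + K) (Suc j) (real K * (g j)\<^sup>2 / (8 * (real T)\<^sup>2 * real n)) \<omega>)"
    if "j \<le> T" for j
  proof -
    have "Suc j * K \<le> Suc T * K" using that by (intro mult_le_mono1) simp
    then have "Suc j * K \<le> m" using K(2) by (rule le_trans)
    then have "j * K + K \<le> m" by (simp add: add.commute)
    from round_event[OF this K(1) g0 T n, of j j] show ?thesis by blast
  qed
  then obtain E where E: "\<And>j. j \<le> T \<Longrightarrow> E j \<in> sets ?M"
      "\<And>j. j \<le> T \<Longrightarrow> measure ?M (E j) \<le> 8 / (real K * g j)"
      "\<And>j \<omega>. j \<le> T \<Longrightarrow> valid_run T \<omega> \<Longrightarrow> occupied_probes T (j * K) j (g j) \<omega> \<Longrightarrow> \<omega> \<notin> E j \<Longrightarrow>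
       occupied_probes T (j * K + K) (Suc j) (real K * (g j)\<^sup>2 / (8 * (real T)\<^sup>2 * real n)) \<omega>"
    by metis
  have valid_E: "\<omega> \<in> (\<Union>j\<le>T. E j)" if v: "valid_run T \<omega>" for \<omega>
  proof (rule ccontr)
    assume notE: "\<omega> \<notin> (\<Union>j\<le>T. E j)"
    have "occupied_probes T (j * K) j (g j) \<omega>" if "j \<le> Suc T" for j
      using that
    proof (induction j)
      case 0
      have "probes_in {} B = space D" for B by (simp add: probes_in_def)
      then show ?case by (auto simp: occupied_probes_def g_def D.prob_space)
    next
      case (Suc j)
      have "\<omega> \<notin> E j" using notE Suc.prems by auto
      then have "occupied_probes T (j * K + K) (Suc j) (real K * (g j)\<^sup>2 / (8 * (real T)\<^sup>2 * real n)) \<omega>"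
        using E(3)[OF _ v] Suc by simp
      moreover have "g (Suc j) \<le> real K * (g j)\<^sup>2 / (8 * (real T)\<^sup>2 * real n)"
        unfolding g_Suc using mult_right_mono[OF \<kappa>(3), of "(g j)\<^sup>2"] by simp
      ultimately show ?case
        unfolding occupied_probes_def by (metis add.commute mult_Suc order_trans)
    qed
    then obtain J where "J \<subseteq> {1..T}" "card J = Suc T" unfolding occupied_probes_def by blast
    then show False using card_mono[of "{1..T}" J] by simp
  qed
  have "measure ?M {\<omega> \<in> space ?M. \<forall>i\<in>{1..m}. probe_complexity choice i \<omega> \<le> T} \<le> measure ?M (\<Union>j\<le>T. E j)"
    by (rule prob_valid_le[OF valid_E]) (use E in auto)
  also have "\<dots> \<le> (\<Sum>j\<le>T. measure ?M (E j))"
    using E by (intro M.finite_measure_subadditive_finite) auto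
  also have "\<dots> \<le> (\<Sum>j\<le>T. 8 / (real K * \<kappa> ^ (2 ^ T)))"
  proof (intro sum_mono)
    fix j assume "j \<in> {..T}"
    then have "\<kappa> ^ (2 ^ T) \<le> g j"
      unfolding g_def using \<kappa> by (intro power_decreasing) (auto intro: le_trans[OF diff_le_self] power_increasing)
    then have "8 / (real K * g j) \<le> 8 / (real K * \<kappa> ^ (2 ^ T))"
      using K \<kappa> by (intro divide_left_mono mult_left_mono mult_pos_pos g0) auto
    then show "measure ?M (E j) \<le> 8 / (real K * \<kappa> ^ (2 ^ T))"
      using E(2)[of j] \<open>j \<in> {..T}\<close> by auto
  qed
  finally show ?thesis by simp
qed

text \<open>The failure bound becomes \<open>64 * T\<^sup>2 / (c * n * \<kappa> ^ (2 ^ T))\<close>.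
  With \<open>b\<close> the base in the assumption on \<open>n\<close>,
  \<open>b * \<kappa> = 4\<close>, so \<open>n > b ^ (2 ^ T + 1)\<close> outweighs the power of
  \<kappa>.\<close>

lemma prob_valid_less_half_loglog:
  assumes c: "0 < c" "c \<le> 1" "c * real n \<le> real m" and T: "T \<ge> 1"
    and n: "real n > (128 * real T ^ 3 / c) ^ (2 ^ T + 1)"
  shows "measure (run_space m D R) {\<omega> \<in> space (run_space m D R). \<forall>i\<in>{1..m}. probe_complexity choice i \<omega> \<le> T} < 1/2"
proof -
  define b where "b = 128 * real T ^ 3 / c"
  have T': "1 \<le> real T" using T by simp
  have T3: "1 \<le> real T ^ 3" "real T ^ 2 \<le> real T ^ 3" "real T \<le> real T ^ 3"
    using T' power_increasing[of 2 3 "real T"] power_increasing[of 1 3 "real T"] by auto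
  have b: "b \<ge> 128 * real T ^ 3" "b > 0"
  proof -
    have "128 * real T ^ 3 * c \<le> 128 * real T ^ 3 * 1" using c by (intro mult_left_mono) auto
    then show "128 * real T ^ 3 \<le> b" using c by (simp add: b_def pos_le_divide_eq)
    then show "b > 0" using T3 by linarith
  qed
  have "b ^ 1 \<le> b ^ (2 ^ T + 1)" using b T3 by (intro power_increasing) auto
  then have n_b: "real n > b" using n by (simp add: b_def)
  define K where "K = m div Suc T"
  have m_large: "real m \<ge> 128 * real T"
  proof -
    have "128 * real T \<le> c * b" using T3 c by (simp add: b_def)
    also have "\<dots> \<le> c * real n" using n_b c by simp
    finally show ?thesis using c by linarith
  qed
  \<comment> \<open>Replacing \<open>T + 1\<close> by \<open>2 * T\<close> costs one factor 2 and
    rounding down at most another.\<close>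
  have K_ge: "real K \<ge> real m / (4 * real T)"
  proof -
    have "m < (K + 1) * Suc T"
      using dividend_less_div_times[of "Suc T" m] by (simp add: K_def algebra_simps)
    then have "real m < real ((K + 1) * Suc T)" by (simp only: of_nat_less_iff)
    also have "\<dots> = (real K + 1) * (real T + 1)" by (simp add: algebra_simps)
    also have "\<dots> \<le> (real K + 1) * (2 * real T)" using T' by (intro mult_left_mono) auto
    finally have "real m < 2 * (real K * real T) + 2 * real T" by (simp add: algebra_simps)
    then have "real m \<le> 4 * (real K * real T)" using m_large T' by linarith
    then show ?thesis using T' by (simp add: field_simps)
  qed
  then have "real K > 0" using m_large T' by (smt (verit) divide_pos_pos)
  then have K1: "K \<ge> 1" by simp
  have n1: "n \<ge> 1" using n_b b by (cases n) auto
  \<comment> \<open>This is \<open>K / (8 * T\<^sup>2 * n)\<close> with \<open>K\<close> replaced by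
    its lower bound \<open>c * n / (4 * T)\<close>.\<close>
  define \<kappa> where "\<kappa> = c / (32 * real T ^ 3)"
  have "c \<le> 32 * real T ^ 3" using c T3(1) by linarith
  then have \<kappa>: "0 < \<kappa>" "\<kappa> \<le> 1" using c T' by (simp_all add: \<kappa>_def pos_divide_le_eq)
  have cn_K: "c * real n / (4 * real T) \<le> real K"
  proof -
    have "c * real n / (4 * real T) \<le> real m / (4 * real T)" using c by (intro divide_right_mono) auto
    then show ?thesis using K_ge by linarith
  qed
  have "\<kappa> = c * real n / (4 * real T) / (8 * (real T)\<^sup>2 * real n)"
    using n1 by (simp add: \<kappa>_def power_eq_if)
  also have "\<dots> \<le> real K / (8 * (real T)\<^sup>2 * real n)"
    using cn_K by (intro divide_right_mono) auto
  finally have \<kappa>_le: "\<kappa> \<le> real K / (8 * (real T)\<^sup>2 * real n)" .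
  have "Suc T * K \<le> m" unfolding K_def by (rule times_div_less_eq_dividend)
  from prob_valid_le_rounds[OF K1 this T n1 \<kappa> \<kappa>_le]
  have "measure (run_space m D R) {\<omega> \<in> space (run_space m D R). \<forall>i\<in>{1..m}. probe_complexity choice i \<omega> \<le> T}
    \<le> real (Suc T) * (8 / (real K * \<kappa> ^ (2 ^ T)))" .
  also have "\<dots> \<le> 2 * real T * (8 / (c * real n / (4 * real T) * \<kappa> ^ (2 ^ T)))"
    using cn_K \<kappa> c n1 T' \<open>real K > 0\<close>
    by (intro mult_mono divide_left_mono mult_right_mono mult_pos_pos divide_pos_pos) auto
  also have "\<dots> = 64 * (real T)\<^sup>2 / c / (real n * \<kappa> ^ (2 ^ T))"
    by (simp add: power2_eq_square)
  also have "\<dots> < 1/2"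
  proof -
    have "1 \<le> b * \<kappa>" using c T' by (simp add: b_def \<kappa>_def)
    then have "1 \<le> (b * \<kappa>) ^ (2 ^ T)" by (rule one_le_power)
    have "128 * (real T)\<^sup>2 / c \<le> b * 1" using T3 c by (simp add: b_def divide_right_mono)
    also have "\<dots> \<le> b * (b * \<kappa>) ^ (2 ^ T)" using \<open>1 \<le> (b * \<kappa>) ^ (2 ^ T)\<close> b by (intro mult_left_mono) auto
    also have "\<dots> = b ^ (2 ^ T + 1) * \<kappa> ^ (2 ^ T)" by (simp add: power_mult_distrib)
    also have "\<dots> < real n * \<kappa> ^ (2 ^ T)" using n \<kappa> by (intro mult_strict_right_mono) (auto simp: b_def)
    finally have "64 * (real T)\<^sup>2 / c < 1/2 * (real n * \<kappa> ^ (2 ^ T))" by simp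
    then show ?thesis using n1 \<kappa> by (subst pos_divide_less_eq) auto
  qed
  finally show ?thesis .
qed

section \<open>Combining both bounds\<close>

text \<open>Passes from integer bounds \<open>T\<close> to a real threshold \<open>y\<close>. For
  \<open>y \<le> 1\<close> the claim is trivial, as every probe complexity is at least 1 and
  \<open>m \<ge> 1\<close>.\<close>

lemma prob_large_probe_complexity:
  assumes less: "\<And>T::nat. real T < x \<Longrightarrow> T \<ge> 1 \<Longrightarrow> measure (run_space m D R) {\<omega> \<in> space (run_space m D R). \<forall>i\<in>{1..m}. probe_complexity choice i \<omega> \<le> T} < 1/2"
    and m: "m \<ge> 1" and y: "y \<le> x \<or> y \<le> 1"
  shows "measure (run_space m D R) {\<omega> \<in> space (run_space m D R). \<exists>i\<in>{1..m}. real (probe_complexity choice i \<omega>) \<ge> y} > 1/2"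
proof -
  interpret M: prob_space "run_space m D R" by (rule prob_run_space)
  \<comment> \<open>For \<open>x > 1\<close> this is the largest integer strictly below
    \<open>x\<close>, also for integral \<open>x\<close>; exceeding it means reaching
    \<open>x\<close>.\<close>
  define T where "T = nat (\<lceil>x\<rceil> - 1)"
  let ?M = "run_space m D R"
  let ?A = "{\<omega> \<in> space ?M. \<exists>i\<in>{1..m}. real (probe_complexity choice i \<omega>) \<ge> y}"
  let ?B = "{\<omega> \<in> space ?M. \<forall>i\<in>{1..m}. probe_complexity choice i \<omega> \<le> T}"
  have meas: "{\<omega> \<in> space ?M. P (probe_complexity choice i \<omega>)} \<in> sets ?M" if "i \<in> {1..m}" for i P
  proof -
    have "{\<omega> \<in> space ?M. P (probe_complexity choice i \<omega>)} = probe_complexity choice i -` {k \<in> {1..}. P k} \<inter> space ?M"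
      using probe_complexity_ge_1[OF _ that] by auto
    also have "\<dots> \<in> sets ?M"
      by (rule measurable_sets[OF probe_complexity_measurable[OF that order_refl]]) auto
    finally show ?thesis .
  qed
  have A: "?A \<in> sets ?M" by (intro sets.sets_Collect_finite_Ex meas) auto
  have B: "?B \<in> sets ?M" by (intro sets.sets_Collect_finite_All meas) auto
  show ?thesis
  proof (cases "y \<le> 1")
    case True
    have "?A = space ?M"
    proof (intro equalityI subsetI)
      fix \<omega> assume "\<omega> \<in> space ?M"
      then show "\<omega> \<in> ?A"
        using probe_complexity_ge_1[of \<omega> 1] m True by (auto intro!: bexI[of _ 1])
    qed auto
    then show ?thesis using M.prob_space by simp
  next
    case False
    then have yx: "y \<le> x" "x > 1" using y by auto
    have T_eq: "int T = \<lceil>x\<rceil> - 1" using yx by (simp add: T_def)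
    then have "real T = real_of_int \<lceil>x\<rceil> - 1" by (metis of_int_1 of_int_diff of_int_of_nat_eq)
    then have Tx: "real T < x" by linarith
    have T1: "T \<ge> 1" using T_eq yx by linarith
    have "space ?M - ?B \<subseteq> ?A"
    proof
      fix \<omega> assume "\<omega> \<in> space ?M - ?B"
      then obtain i where i: "\<omega> \<in> space ?M" "i \<in> {1..m}" "probe_complexity choice i \<omega> > T" by (auto simp: not_le)
      then have "real (probe_complexity choice i \<omega>) \<ge> real T + 1" by linarith
      then have "real (probe_complexity choice i \<omega>) \<ge> y"
        using \<open>real T = real_of_int \<lceil>x\<rceil> - 1\<close> yx by linarith
      then show "\<omega> \<in> ?A" using i by auto
    qed
    then have "M.prob (space ?M - ?B) \<le> M.prob ?A" using A by (rule M.finite_measure_mono)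
    then show ?thesis using less[OF Tx T1] M.prob_compl[OF B] by linarith
  qed
qed

end

theorem theorem7:
  fixes c :: real
  assumes "c > 0"
  shows "\<exists>C>0. \<forall>(n::nat) (m::nat) (\<delta>::real) D R choice.
    0 < \<delta> \<and> \<delta> < 1 \<and> 1 - \<delta> \<ge> c \<and> real m = real n * (1 - \<delta>) \<and>
    open_addressing_scheme n m D R choice \<longrightarrow>
    measure (run_space m D R)
      {\<omega> \<in> space (run_space m D R). \<exists>i\<in>{1..m}.
         real (probe_complexity choice i \<omega>)
           \<ge> C * (log 2 (log 2 (real n)) + (log 2 (1 / \<delta>))\<^sup>2)} > 1/2"
proof -
  obtain l0 :: real where l0: "l0 \<ge> 8"
    "\<And>l. l \<ge> l0 \<Longrightarrow> 2 powr (- l / 4) < 1/8"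
    "\<And>l. l \<ge> l0 \<Longrightarrow> l * 2 powr (- l / 4) < 8"
    "\<And>l. l \<ge> l0 \<Longrightarrow> l ^ 4 * 2 powr (- l / 4) < 1"
    using log_squared_threshold by blast
  obtain N :: nat where N: "N \<ge> 1"
    "\<And>(T::nat) x. T \<ge> 1 \<Longrightarrow> 2 ^ (2 ^ (N * T)) \<le> x \<Longrightarrow> (128 * real T ^ 3 / c) ^ (2 ^ T + 1) < x"
    using loglog_threshold[OF assms] by metis
  \<comment> \<open>One constant for each case below; each includes a factor 1/2 because the sum of
    the two terms is at most twice the larger.\<close>
  define C where "C = Min {1 / (2 * real N), 1 / 2048, 1 / (2 * l0\<^sup>2)}"
  have C: "C > 0" "C \<le> 1 / (2 * real N)" "C \<le> 1 / 2048" "C \<le> 1 / (2 * l0\<^sup>2)"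
    using N l0 by (auto simp: C_def)
  have main: "measure (run_space m D R)
      {\<omega> \<in> space (run_space m D R). \<exists>i\<in>{1..m}.
         real (probe_complexity choice i \<omega>)
           \<ge> C * (log 2 (log 2 (real n)) + (log 2 (1 / \<delta>))\<^sup>2)} > 1/2"
    if \<delta>: "0 < \<delta>" "\<delta> < 1" "1 - \<delta> \<ge> c" and m: "real m = real n * (1 - \<delta>)"
      and scheme: "open_addressing_scheme n m D R choice" for n m \<delta> D R choice
  proof -
    interpret open_addressing_scheme n m D R choice by (rule scheme)
    interpret D: prob_space D by (rule prob_D)
    \<comment> \<open>For \<open>n = 0\<close> there are no probe sequences, so \<open>D\<close>
      could not be a probability measure.\<close>
    have n: "n \<ge> 1"
    proof (rule ccontr)
      assume "\<not> n \<ge> 1"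
      then have "space D = {}" by (auto simp: space_D PiE_eq_empty_iff)
      then show False using D.not_empty by simp
    qed
    have m1: "m \<ge> 1" using m n \<delta> by (cases m) auto
    define L where "L = log 2 (log 2 (real n))"
    define l where "l = log 2 (1 / \<delta>)"
    let ?y = "C * (L + l\<^sup>2)"
    \<comment> \<open>Small \<open>l\<close> makes the threshold at most 1; otherwise the larger
      term decides which of the two bounds applies.\<close>
    consider "l < l0" "L \<le> l\<^sup>2" | "l \<ge> l0" "L \<le> l\<^sup>2" | "l\<^sup>2 < L" by linarith
    then have "measure (run_space m D R)
        {\<omega> \<in> space (run_space m D R). \<exists>i\<in>{1..m}. real (probe_complexity choice i \<omega>) \<ge> ?y} > 1/2"
    proof cases
      case 1
      have "l > 0" using \<delta> by (simp add: l_def)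
      have "?y \<le> C * (2 * l\<^sup>2)" using 1 C by (intro mult_left_mono) auto
      also have "\<dots> \<le> 1 / (2 * l0\<^sup>2) * (2 * l0\<^sup>2)"
        using C 1 \<open>l > 0\<close> by (intro mult_mono power_mono) auto
      also have "\<dots> = 1" using l0 by simp
      finally show ?thesis
        using m1 by (intro prob_large_probe_complexity[where x = 0]) auto
    next
      case 2
      have "?y \<le> C * (2 * l\<^sup>2)" using 2 C by (intro mult_left_mono) auto
      also have "\<dots> \<le> 1 / 2048 * (2 * l\<^sup>2)" using C by (intro mult_right_mono) auto
      finally have y: "?y \<le> l\<^sup>2 / 1024" by simp
      show ?thesis
      proof (rule prob_large_probe_complexity[where x = "l\<^sup>2 / 1024"])
        fix T :: nat assume "real T < l\<^sup>2 / 1024"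
        then show "measure (run_space m D R)
          {\<omega> \<in> space (run_space m D R). \<forall>i\<in>{1..m}. probe_complexity choice i \<omega> \<le> T} < 1/2"
          using 2 l0 n by (intro prob_valid_less_half_load[OF \<delta>(1,2) m l_def]) auto
      qed (use m1 y in auto)
    next
      case 3
      then have L: "L > 0" using zero_le_power2[of l] by linarith
      have "?y \<le> C * (2 * L)" using 3 C by (intro mult_left_mono) auto
      also have "\<dots> \<le> 1 / (2 * real N) * (2 * L)" using C L by (intro mult_right_mono) auto
      finally have y: "?y \<le> L / real N" by simp
      \<comment> \<open>Excluding \<open>n = 1\<close> makes the inner logarithm positive, so that
        the outer one can be undone.\<close>
      have "n \<noteq> 1" using m m1 \<delta> by auto
      then have log_n: "log 2 (real n) > 0" using n by simp
      show ?thesis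
      proof (rule prob_large_probe_complexity[where x = "L / real N"])
        fix T :: nat assume T: "real T < L / real N" "T \<ge> 1"
        then have "real (N * T) < log 2 (log 2 (real n))" using N by (simp add: L_def field_simps)
        then have "2 powr real (N * T) < log 2 (real n)" using log_n by (subst (asm) less_log_iff) auto
        then have "2 powr (2 powr real (N * T)) < real n" using n by (subst (asm) less_log_iff) auto
        moreover have "2 powr real (N * T) = real (2 ^ (N * T))"
          using powr_realpow[of 2 "N * T"] by (simp only: of_nat_power of_nat_numeral)
        ultimately have "2 ^ (2 ^ (N * T)) < real n"
          using powr_realpow[of 2 "2 ^ (N * T)"] by (simp only: zero_less_numeral)
        then have "2 ^ (2 ^ (N * T)) \<le> real n" by (rule less_imp_le)
        from N(2)[OF T(2) this]
        show "measure (run_space m D R)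
          {\<omega> \<in> space (run_space m D R). \<forall>i\<in>{1..m}. probe_complexity choice i \<omega> \<le> T} < 1/2"
          using assms \<delta> m T mult_left_mono[of c "1 - \<delta>" "real n"]
          by (intro prob_valid_less_half_loglog) (auto simp: mult.commute)
      qed (use m1 y in auto)
    qed
    then show ?thesis unfolding L_def l_def .
  qed
  show ?thesis
    by (rule exI[of _ C]) (use C main in blast)
qed

end
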